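(* Let $1\le k\le n$, write $x=(x',x'')\in\mathbb{R}^k\times\mathbb{R}^{n-k}$, let $1<p<\infty$ and $\alpha\in\mathbb{R}$. (i) For all complex-valued $f\in C_0^\infty(\mathbb{R}^n\setminus\{x'=0\})$, $$\left|\frac{k-\alpha}{p}\right|^p\int_{\mathbb{R}^n}\frac{|f(x)|^p}{|x'|_k^{\alpha}}\,dx\;\le\;\int_{\mathbb{R}^n}\frac{|x'\cdot\nabla_k f(x)|^p}{|x'|_k^{\alpha}}\,dx .$$ Moreover, if $\alpha\neq k$ the constant $\left|\frac{k-\alpha}{p}\right|^p$ is sharp: for every $C>\left|\frac{k-\alpha}{p}\right|^p$ there exists such an $f$ with $C\int_{\mathbb{R}^n}|f|^p|x'|_k^{-\alpha}dx>\int_{\mathbb{R}^n}|x'\cdot\nabla_k f|^p|x'|_k^{-\alpha}dx$. (ii) For all complex-valued $f\in C_0^\infty(\mathbb{R}^n\setminus\{x'=0\})$ the identity $$\left|\frac{k-\alpha}{p}\right|^p\left\|\frac{f}{|x'|_k^{\alpha/p}}\right\|_{L^p(\mathbb{R}^n)}^p=\left\|\frac{x'\cdot\nabla_k f}{|x'|_k^{\alpha/p}}\right\|_{L^p(\mathbb{R}^n)}^p-\int_{\mathbb{R}^n}C_p\!\left(\frac{x'\cdot\nabla_k f}{|x'|_k^{\alpha/p}},\;\frac{x'\cdot\nabla_k f}{|x'|_k^{\alpha/p}}+\frac{k-\alpha}{p}\frac{f}{|x'|_k^{\alpha/p}}\right)dx$$ holds. (iii) If $p\ge 2$, then for every nonzero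 such $f$ the integral of $C_p$ in (ii) is strictly positive (it vanishes only if $f=|x'|_k^{-(k-\alpha)/p}\varphi(x'/|x'|_k,x'')$ for some function $\varphi$, which for $f\in C_0^\infty(\mathbb{R}^n\setminus\{x'=0\})$ forces $f=0$); consequently the inequality in (i) is strict for every nonzero $f$, i.e. the sharp constant is not attained in $C_0^\infty(\mathbb{R}^n\setminus\{x'=0\})$.
   Context: $|\cdot|_k$ denotes the Euclidean norm on $\mathbb{R}^k$, $\nabla_k=(\partial_{x_1},\dots,\partial_{x_k})$ is the gradient in the $x'$ variables, and $x'\cdot\nabla_k f=\sum_{j=1}^k x_j\partial_{x_j}f$. For complex numbers $\xi,\eta$ and $1<p<\infty$, $$C_p(\xi,\eta):=|\xi|^p-|\xi-\eta|^p-p|\xi-\eta|^{p-2}\operatorname{Re}\big((\xi-\eta)\overline{\eta}\big),$$ with the last term interpreted as $0$ when $\xi=\eta$. *)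

theory Defs
  imports "HOL-Analysis.Analysis"
begin

text \<open>Points of R^n are vectors x :: real^'n with n = CARD('n).  The splitting
  x = (x',x'') is given by a nonempty index set K of coordinates with card K = k:
  x' consists of the coordinates in K, x'' of the remaining ones.\<close>

definition normK :: "'n::finite set \<Rightarrow> real^'n \<Rightarrow> real" where
  "normK K x = sqrt (\<Sum>i\<in>K. (x $ i)\<^sup>2)"

definition partial :: "'n::finite \<Rightarrow> (real^'n \<Rightarrow> complex) \<Rightarrow> real^'n \<Rightarrow> complex" where
  "partial i f x = vector_derivative (\<lambda>t. f (x + t *\<^sub>R axis i 1)) (at 0)"

fun iter_partial :: "'n::finite list \<Rightarrow> (real^'n \<Rightarrow> complex) \<Rightarrow> real^'n \<Rightarrow> complex" where
  "iter_partial [] f = f"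
| "iter_partial (i # is) f = partial i (iter_partial is f)"

definition smooth_fun :: "(real^'n::finite \<Rightarrow> complex) \<Rightarrow> bool" where
  "smooth_fun f \<longleftrightarrow>
     (\<forall>is. continuous_on UNIV (iter_partial is f) \<and>
        (\<forall>i x. (\<lambda>t. iter_partial is f (x + t *\<^sub>R axis i 1)) differentiable (at 0)))"

definition test_fun :: "'n::finite set \<Rightarrow> (real^'n \<Rightarrow> complex) set" where
  "test_fun K = {f. smooth_fun f \<and> compact (closure {x. f x \<noteq> 0}) \<and>
                    closure {x. f x \<noteq> 0} \<inter> {x. \<forall>i\<in>K. x $ i = 0} = {}}"

definition euler_op :: "'n::finite set \<Rightarrow> (real^'n \<Rightarrow> complex) \<Rightarrow> real^'n \<Rightarrow> complex" where
  "euler_op K f x = (\<Sum>i\<in>K. complex_of_real (x $ i) * partial i f x)"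

definition Cp :: "real \<Rightarrow> complex \<Rightarrow> complex \<Rightarrow> real" where
  "Cp p \<xi> \<eta> = (if \<xi> = \<eta> then norm \<xi> powr p
     else norm \<xi> powr p - norm (\<xi> - \<eta>) powr p
          - p * norm (\<xi> - \<eta>) powr (p - 2) * Re ((\<xi> - \<eta>) * cnj \<eta>))"

end

theory Submission
  imports Defs
begin

text \<open>
  Write \<open>N\<close> for the norm of \<open>x'\<close>, \<open>E\<close> for the Euler operator and \<open>c = (k - \<alpha>)/p\<close>.
  Since \<open>div (x' N\<^sup>-\<^sup>\<alpha>) = (k - \<alpha>) N\<^sup>-\<^sup>\<alpha>\<close>, integrating the divergence of \<open>x' N\<^sup>-\<^sup>\<alpha> |f|\<^sup>p\<close> expresses
  \<open>\<integral> |f|\<^sup>p\<^sup>-\<^sup>2 Re (f cnj (E f)) N\<^sup>-\<^sup>\<alpha>\<close> through \<open>\<integral> |f|\<^sup>p N\<^sup>-\<^sup>\<alpha>\<close>, which is the identity (ii). Convexity of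
  \<open>|z|\<^sup>p\<close> gives \<open>C\<^sub>p(\<xi>, \<eta>) > 0\<close> for \<open>\<eta> \<noteq> 0\<close>, hence (i). If the remainder integral vanishes then
  \<open>E f = - c f\<close> almost everywhere, and (i) for an exponent \<open>\<beta>\<close> with \<open>|k - \<beta>| > |k - \<alpha>|\<close> forces \<open>f = 0\<close>.

  The constant is approached by \<open>N\<^sup>-\<^sup>c \<psi>(\<epsilon> ln N) \<chi>(x'')\<close> with bump functions \<open>\<psi>\<close> and \<open>\<chi>\<close>, for which
  \<open>E f = N\<^sup>-\<^sup>c (- c \<psi> + \<epsilon> \<psi>')(\<epsilon> ln N) \<chi>\<close>. The \<open>\<psi>'\<close> term is absorbed because the measure \<open>N\<^sup>-\<^sup>k dx\<close> is
  invariant under dilations of \<open>x'\<close>, so that doubling the range of \<open>ln N\<close> at most doubles the mass.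
\<close>

section \<open>Integrals of directional derivatives\<close>

lemma integrable_continuous_on_compact_support:
  fixes h :: "'a::euclidean_space \<Rightarrow> real"
  assumes "compact S" "continuous_on S h" and "\<And>x. x \<notin> S \<Longrightarrow> h x = 0"
  shows "integrable lborel h"
proof -
  have "(\<lambda>x. indicator S x *\<^sub>R h x) = h"
    using assms(3) by (auto simp: indicator_def fun_eq_iff)
  then show ?thesis using borel_integrable_compact[OF assms(1,2)] by simp
qed

text \<open>Difference quotients along \<open>v\<close> with step 1/(n+1) have integral zero by
  translation invariance of \<open>lborel\<close>. The mean value theorem bounds them by
  \<open>M\<close> and they vanish outside a fixed ball, so dominated convergence passes to the
  limit \<open>h'\<close>, whose measurability also comes from that limit.\<close>

lemma
  fixes h h' :: "'a::euclidean_space \<Rightarrow> real" and v :: 'a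
  assumes cont: "continuous_on UNIV h"
    and der: "\<And>x. ((\<lambda>t. h (x + t *\<^sub>R v)) has_real_derivative h' x) (at 0)"
    and bdd: "\<And>x. \<bar>h' x\<bar> \<le> M"
    and supp: "bounded {x. h x \<noteq> 0}"
  shows integrable_directional_derivative: "integrable lborel h'"
    and integral_directional_derivative: "integral\<^sup>L lborel h' = 0"
proof -
  define q where "q n x = (h (x + (1 / real (Suc n)) *\<^sub>R v) - h x) * real (Suc n)" for n x
  have der_at: "((\<lambda>t. h (x + t *\<^sub>R v)) has_real_derivative h' (x + s *\<^sub>R v)) (at s)" for x s
    using DERIV_shift[of "\<lambda>t. h (x + t *\<^sub>R v)" "h' (x + s *\<^sub>R v)" 0 s] der[of "x + s *\<^sub>R v"]
    by (simp add: algebra_simps)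
  have q_bdd: "\<bar>q n x\<bar> \<le> M" for n x
  proof -
    have "\<exists>z>0. z < 1 / real (Suc n) \<and>
        h (x + (1 / real (Suc n)) *\<^sub>R v) - h (x + 0 *\<^sub>R v) = (1 / real (Suc n) - 0) * h' (x + z *\<^sub>R v)"
      by (rule MVT2) (use der_at in auto)
    then obtain z where z: "h (x + (1 / real (Suc n)) *\<^sub>R v) - h x = (1 / real (Suc n)) * h' (x + z *\<^sub>R v)"
      by auto
    show ?thesis using bdd[of "x + z *\<^sub>R v"] unfolding q_def z by simp
  qed
  obtain B where B: "\<And>x. h x \<noteq> 0 \<Longrightarrow> norm x \<le> B"
    using supp unfolding bounded_iff by auto
  have inth: "integrable lborel h"
  proof (rule integrable_continuous_on_compact_support[of "cball 0 B"])
    show "continuous_on (cball 0 B) h" using cont continuous_on_subset by blast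
  qed (use B in auto)
  have q_supp: "q n x = 0" if "norm x > B + norm v" for n x
  proof -
    have "norm x \<le> norm (x + (1 / real (Suc n)) *\<^sub>R v) + norm ((1 / real (Suc n)) *\<^sub>R v)"
      using norm_triangle_ineq4[of "x + (1 / real (Suc n)) *\<^sub>R v" "(1 / real (Suc n)) *\<^sub>R v"] by simp
    also have "norm ((1 / real (Suc n)) *\<^sub>R v) \<le> norm v"
      using mult_right_mono[of "1 / real (Suc n)" 1 "norm v"] by simp
    finally have "h (x + (1 / real (Suc n)) *\<^sub>R v) = 0" using B that by fastforce
    moreover have "h x = 0" using B that norm_ge_zero[of v] by fastforce
    ultimately show ?thesis by (simp add: q_def)
  qed
  have meas: "h \<in> borel_measurable borel"
    by (rule borel_measurable_continuous_onI[OF cont])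
  have shift_int: "integrable lborel (\<lambda>x. h (x + w))" "(\<integral>x. h (x + w) \<partial>lborel) = integral\<^sup>L lborel h" for w
  proof -
    show "(\<integral>x. h (x + w) \<partial>lborel) = integral\<^sup>L lborel h"
      using integral_distr[of "(+) w" lborel borel h] meas lborel_distr_plus[of w]
      by (simp add: add.commute[of _ w])
    show "integrable lborel (\<lambda>x. h (x + w))"
      using integrable_distr_eq[of "(+) w" lborel borel h] meas lborel_distr_plus[of w] inth
      by (simp add: add.commute[of _ w])
  qed
  have q_int: "integral\<^sup>L lborel (q n) = 0" for n
    unfolding q_def by (simp add: shift_int inth)
  have q_meas: "q n \<in> borel_measurable lborel" for n
    unfolding q_def using borel_measurable_integrable[OF shift_int(1)] meas by simp
  have q_lim: "(\<lambda>n. q n x) \<longlonglongrightarrow> h' x" for x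
  proof -
    have "((\<lambda>t. (h (x + t *\<^sub>R v) - h x) / t) \<longlongrightarrow> h' x) (at 0)"
      using der[of x] by (simp add: DERIV_def)
    moreover have "filterlim (\<lambda>n. 1 / real (Suc n)) (at 0) sequentially"
      using LIMSEQ_inverse_real_of_nat by (auto simp: filterlim_at inverse_eq_divide)
    ultimately have "(\<lambda>n. (h (x + (1 / real (Suc n)) *\<^sub>R v) - h x) / (1 / real (Suc n))) \<longlonglongrightarrow> h' x"
      by (rule filterlim_compose)
    then show ?thesis by (simp add: q_def)
  qed
  have h'_meas: "h' \<in> borel_measurable lborel"
    by (rule borel_measurable_LIMSEQ_real[OF q_lim q_meas])
  define D where "D = (\<lambda>x. M * indicator (cball (0::'a) (B + norm v)) x)"
  have D: "integrable lborel D"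
    unfolding D_def
    by (intro integrable_mult_right integrable_real_indicator)
       (use emeasure_lborel_cball_finite in auto)
  have dom: "AE x in lborel. norm (q n x) \<le> D x" for n
    using q_bdd[of n] q_supp[of _ n] by (intro AE_I2) (auto simp: D_def indicator_def)
  have lim: "AE x in lborel. (\<lambda>n. q n x) \<longlonglongrightarrow> h' x" using q_lim by simp
  show "integrable lborel h'"
    by (rule integrable_dominated_convergence[OF h'_meas q_meas D lim dom])
  have "(\<lambda>n. integral\<^sup>L lborel (q n)) \<longlonglongrightarrow> integral\<^sup>L lborel h'"
    by (rule integral_dominated_convergence[OF h'_meas q_meas D lim dom])
  then show "integral\<^sup>L lborel h' = 0"
    unfolding q_int by (simp add: LIMSEQ_const_iff)
qed

text \<open>Away from zeros of \<open>z\<close> this is the chain rule through the norm. At a zero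
  the claimed value is 0, and indeed |z|^p is o(h) there because p > 1.\<close>

lemma has_real_derivative_norm_powr:
  fixes z :: "real \<Rightarrow> complex"
  assumes z: "(z has_vector_derivative z') (at t)" and p: "1 < p"
  shows "((\<lambda>s. norm (z s) powr p) has_real_derivative
           p * norm (z t) powr (p - 2) * Re (z t * cnj z')) (at t)"
proof (cases "z t = 0")
  case False
  have "((\<lambda>s. norm (z s)) has_derivative (\<lambda>h. (h *\<^sub>R z') \<bullet> sgn (z t))) (at t)"
    using has_derivative_compose[OF z[unfolded has_vector_derivative_def] has_derivative_norm[OF False]]
    by simp
  then have n: "((\<lambda>s. norm (z s)) has_real_derivative (z' \<bullet> sgn (z t))) (at t)"
    by (simp add: has_field_derivative_def mult.commute[of _ "_ \<bullet> _"])
  have "((\<lambda>s. norm (z s) powr p) has_real_derivative (p * norm (z t) powr (p - 1)) * (z' \<bullet> sgn (z t))) (at t)"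
    using DERIV_chain2[OF has_real_derivative_powr n] False by simp
  moreover have "z' \<bullet> sgn (z t) = Re (z t * cnj z') / norm (z t)"
    by (simp add: sgn_div_norm inner_complex_def divide_inverse distrib_left mult_ac)
  moreover have "norm (z t) powr (p - 1) = norm (z t) powr (p - 2) * norm (z t)"
    using False powr_add[of "norm (z t)" "p - 2" 1] by simp
  ultimately show ?thesis using False by (simp add: mult.assoc)
next
  case True
  have cz: "isCont z t" using z has_vector_derivative_continuous by blast
  \<comment> \<open>The relative error of the linearisation of \<open>z\<close>. It gives
    |z(t+h)|/|h| \<le> e h + |z'|, hence |z(t+h)|^p/|h| \<le> (e h + |z'|) |z(t+h)|^(p-1), which
    tends to 0.\<close>
  define e where "e h = norm (z (t + h) - z t - h *\<^sub>R z') / norm h" for h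
  have e: "(e \<longlongrightarrow> 0) (at 0)"
    using z unfolding has_vector_derivative_def has_derivative_at e_def by simp
  have "((\<lambda>h. norm (z (t + h))) \<longlongrightarrow> 0) (at 0)"
    using LIM_offset_zero[OF cz[unfolded isCont_def]] True by (simp add: tendsto_norm_zero)
  then have "((\<lambda>h. norm (z (t + h)) powr (p - 1)) \<longlongrightarrow> 0 powr (p - 1)) (at 0)"
    by (rule tendsto_powr') (use p in auto)
  then have "((\<lambda>h. (e h + norm z') * norm (z (t + h)) powr (p - 1)) \<longlongrightarrow> (0 + norm z') * 0) (at 0)"
    by (intro tendsto_intros e) simp
  then have lim: "((\<lambda>h. (e h + norm z') * norm (z (t + h)) powr (p - 1)) \<longlongrightarrow> 0) (at 0)" by simp
  have "((\<lambda>h. norm (z (t + h)) powr p / h) \<longlongrightarrow> 0) (at 0)"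
  proof (rule Lim_null_comparison[OF _ lim], rule eventually_at_filter[THEN iffD2], rule always_eventually, intro allI impI)
    fix h :: real assume "h \<noteq> 0"
    have "norm (z (t + h)) = norm ((z (t + h) - z t - h *\<^sub>R z') + h *\<^sub>R z')" using True by simp
    also have "\<dots> \<le> norm (z (t + h) - z t - h *\<^sub>R z') + norm (h *\<^sub>R z')" by (rule norm_triangle_ineq)
    finally have "norm (z (t + h)) / \<bar>h\<bar> \<le> e h + norm z'"
      using \<open>h \<noteq> 0\<close> by (simp add: e_def field_simps)
    then have "norm (z (t + h)) / \<bar>h\<bar> * norm (z (t + h)) powr (p - 1)
        \<le> (e h + norm z') * norm (z (t + h)) powr (p - 1)" by (intro mult_right_mono) auto
    moreover have "norm (z (t + h)) * norm (z (t + h)) powr (p - 1) = norm (z (t + h)) powr p"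
      using powr_add[of "norm (z (t + h))" 1 "p - 1"] by (cases "z (t + h) = 0") auto
    ultimately show "norm (norm (z (t + h)) powr p / h) \<le> (e h + norm z') * norm (z (t + h)) powr (p - 1)"
      by (simp add: abs_divide)
  qed
  then show ?thesis using True p by (simp add: DERIV_def)
qed

section \<open>Convexity of the remainder\<close>

lemma Bernoulli_powr_strict:
  fixes s p :: real
  assumes p: "1 < p" and s: "0 \<le> s" "s \<noteq> 1"
  shows "1 + p * (s - 1) < s powr p"
proof -
  have d: "((\<lambda>x. x powr p) has_real_derivative p * x powr (p - 1)) (at x)" if "0 < x" for x
    using has_real_derivative_powr[OF that] .
  consider "s = 0" | "0 < s" "s < 1" | "1 < s" using s by linarith
  then show ?thesis
  proof cases
    case 1 then show ?thesis using p by simp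
  next
    case 2
    then obtain z where z: "s < z" "z < 1" "1 powr p - s powr p = (1 - s) * (p * z powr (p - 1))"
      using MVT2[of s 1 "\<lambda>x. x powr p" "\<lambda>x. p * x powr (p - 1)"] d by force
    have "z powr (p - 1) < 1 powr (p - 1)"
      by (rule powr_less_mono2) (use z 2 p in auto)
    then have "(1 - s) * (p * z powr (p - 1)) < (1 - s) * (p * 1)"
      using 2 p by (intro mult_strict_left_mono) auto
    then show ?thesis using z(3) by (simp add: algebra_simps)
  next
    case 3
    then obtain z where z: "1 < z" "z < s" "s powr p - 1 powr p = (s - 1) * (p * z powr (p - 1))"
      using MVT2[of 1 s "\<lambda>x. x powr p" "\<lambda>x. p * x powr (p - 1)"] d by force
    have "1 powr (p - 1) < z powr (p - 1)"
      by (rule powr_less_mono2) (use z 3 p in auto)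
    then have "(s - 1) * (p * 1) < (s - 1) * (p * z powr (p - 1))"
      using 3 p by (intro mult_strict_left_mono) auto
    then show ?thesis using z(3) by (simp add: algebra_simps)
  qed
qed

lemma Cp_altdef:
  "Cp p \<xi> \<eta> = norm \<xi> powr p - norm (\<xi> - \<eta>) powr p
          - p * norm (\<xi> - \<eta>) powr (p - 2) * Re ((\<xi> - \<eta>) * cnj \<eta>)"
  by (simp add: Cp_def)

lemma Cp_zero_right [simp]: "Cp p \<xi> 0 = 0"
  by (simp add: Cp_altdef)

text \<open>\<open>Cp\<close> is the gap between |.|^p at \<xi> and its tangent at \<zeta> = \<xi> -
  \<eta>. Cauchy-Schwarz, Re(\<zeta> cnj \<xi>) \<le> b a, reduces the claim to Bernoulli at a/b. If
  a \<noteq> b, Bernoulli is strict; if a = b, Cauchy-Schwarz is strict because \<xi> \<noteq>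
  \<zeta>.\<close>

lemma Cp_pos:
  assumes p: "1 < p" and "\<eta> \<noteq> 0"
  shows "0 < Cp p \<xi> \<eta>"
proof (cases "\<xi> = \<eta>")
  case True
  then show ?thesis using assms by (simp add: Cp_def)
next
  case False
  define \<zeta> where "\<zeta> = \<xi> - \<eta>"
  define a b where "a = norm \<xi>" and "b = norm \<zeta>"
  have b: "0 < b" using False by (simp add: b_def \<zeta>_def)
  have a: "0 \<le> a" by (simp add: a_def)
  have bp: "b powr (p - 2) * b\<^sup>2 = b powr p"
    using powr_add[of b "p - 2" 2] b by simp
  have \<zeta>2: "Re (\<zeta> * cnj \<zeta>) = b\<^sup>2"
    by (simp add: b_def complex_mult_cnj cmod_power2)
  have "Re (\<zeta> * cnj \<eta>) = Re (\<zeta> * cnj \<xi>) - b\<^sup>2"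
    unfolding \<zeta>2[symmetric] by (simp add: \<zeta>_def algebra_simps)
  then have C: "Cp p \<xi> \<eta> = a powr p - b powr p - p * (b powr (p - 2) * Re (\<zeta> * cnj \<xi>)) + p * b powr p"
    unfolding Cp_altdef \<zeta>_def[symmetric] a_def[symmetric] b_def[symmetric] bp[symmetric]
    by (simp only:) (simp only: right_diff_distrib mult.assoc)
  have re_le: "Re (\<zeta> * cnj \<xi>) \<le> b * a"
    using complex_Re_le_cmod[of "\<zeta> * cnj \<xi>"] by (simp add: norm_mult a_def b_def)
  have scale: "b powr p * (a / b) powr p = a powr p"
    using a b by (simp add: powr_divide)
  have bp1: "b powr (p - 2) * (b * a) = b powr p * (a / b)"
    using b bp by (simp add: field_simps power2_eq_square)
  have pow: "0 < b powr (p - 2)" using b by simp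
  show ?thesis
  proof (cases "a = b")
    case True
    \<comment> \<open>The polarisation identity turns \<eta> \<noteq> 0 into strictness of
      Cauchy-Schwarz when a = b.\<close>
    have "norm \<eta> ^ 2 = a\<^sup>2 + b\<^sup>2 - 2 * Re (\<zeta> * cnj \<xi>)"
    proof -
      have \<eta>: "\<eta> = \<xi> - \<zeta>" by (simp add: \<zeta>_def)
      show ?thesis unfolding a_def b_def cmod_power2 \<eta>
        by (simp add: power2_eq_square algebra_simps)
    qed
    moreover have "0 < norm \<eta> ^ 2" using \<open>\<eta> \<noteq> 0\<close> by simp
    ultimately have "Re (\<zeta> * cnj \<xi>) < b * a" using True by (simp add: power2_eq_square)
    then have "p * (b powr (p - 2) * Re (\<zeta> * cnj \<xi>)) < p * (b powr (p - 2) * (b * a))"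
      using pow p by simp
    also have "\<dots> = p * b powr p" unfolding bp1 using True b by simp
    finally show ?thesis unfolding C using True by simp
  next
    case False
    then have "1 + p * (a / b - 1) < (a / b) powr p"
      using Bernoulli_powr_strict[OF p, of "a / b"] a b by auto
    then have "b powr p * (1 + p * (a / b - 1)) < a powr p"
      unfolding scale[symmetric] using b by simp
    moreover have "p * (b powr (p - 2) * Re (\<zeta> * cnj \<xi>)) \<le> p * (b powr p * (a / b))"
      unfolding bp1[symmetric] using pow p re_le by simp
    ultimately show ?thesis unfolding C by (simp add: algebra_simps)
  qed
qed

lemma Cp_nonneg: "1 < p \<Longrightarrow> 0 \<le> Cp p \<xi> \<eta>"
  using Cp_pos[of p \<eta> \<xi>] by (cases "\<eta> = 0") auto

section \<open>The remainder identity\<close>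

lemma normK_nonneg [simp]: "0 \<le> normK K x"
  by (simp add: normK_def sum_nonneg)

lemma normK_power2: "(normK K x)\<^sup>2 = (\<Sum>i\<in>K. (x $ i)\<^sup>2)"
  by (simp add: normK_def sum_nonneg)

lemma normK_eq_0_iff: "normK K x = 0 \<longleftrightarrow> (\<forall>i\<in>K. x $ i = 0)"
  by (simp add: normK_def sum_nonneg_eq_0_iff)

lemma continuous_on_normK [continuous_intros]: "continuous_on A (normK K)"
  unfolding normK_def by (intro continuous_intros)

lemma open_normK_pos: "open {x. 0 < normK K x}"
  by (intro open_Collect_less continuous_intros)

lemma continuous_on_normK_powr:
  "(\<And>x. x \<in> A \<Longrightarrow> 0 < normK K x) \<Longrightarrow> continuous_on A (\<lambda>x. normK K x powr a)"
  by (rule continuous_on_powr) (fastforce intro: continuous_on_normK)+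

lemma continuous_on_norm_powr:
  fixes g :: "'a::topological_space \<Rightarrow> 'b::real_normed_vector"
  assumes "continuous_on A g" "0 < q"
  shows "continuous_on A (\<lambda>x. norm (g x) powr q)"
  using assms by (intro continuous_on_powr' continuous_on_norm continuous_on_const) auto

lemma normK_axis_power2:
  assumes "i \<in> K"
  shows "(normK K (x + t *\<^sub>R axis i 1))\<^sup>2 = (normK K x)\<^sup>2 + (2 * t * x $ i + t\<^sup>2)"
proof -
  have "(normK K (x + t *\<^sub>R axis i 1))\<^sup>2 = (\<Sum>j\<in>K. (x $ j)\<^sup>2 + (if j = i then 2 * t * x $ i + t\<^sup>2 else 0))"
    unfolding normK_power2 by (rule sum.cong) (auto simp: axis_def power2_eq_square algebra_simps)
  also have "\<dots> = (\<Sum>j\<in>K. (x $ j)\<^sup>2) + (2 * t * x $ i + t\<^sup>2)"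
    using assms by (simp add: sum.distrib)
  finally show ?thesis unfolding normK_power2 .
qed

lemma has_real_derivative_normK_axis:
  assumes "i \<in> K" and "0 < normK K x"
  shows "((\<lambda>t. normK K (x + t *\<^sub>R axis i 1)) has_real_derivative x $ i / normK K x) (at 0)"
proof -
  have "((\<lambda>t. sqrt ((normK K x)\<^sup>2 + (2 * t * x $ i + t\<^sup>2))) has_real_derivative x $ i / normK K x) (at 0)"
    using assms(2) by (auto intro!: derivative_eq_intros simp: field_simps)
  then show ?thesis
    by (simp add: normK_axis_power2[OF assms(1), symmetric])
qed

lemma has_vector_derivative_partial:
  assumes "smooth_fun f"
  shows "((\<lambda>t. f (x + t *\<^sub>R axis i 1)) has_vector_derivative partial i f x) (at 0)"
  using assms[unfolded smooth_fun_def, rule_format, of "[]"]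
  by (simp add: partial_def vector_derivative_works)

lemma eventually_axis_notin_closed:
  fixes x :: "real^'n::finite"
  assumes "closed S" "x \<notin> S"
  shows "\<forall>\<^sub>F t in nhds 0. x + t *\<^sub>R axis i 1 \<notin> S"
proof -
  have "open ((\<lambda>t::real. x + t *\<^sub>R axis i 1) -` (- S))"
    using assms(1) by (intro open_vimage continuous_intros) auto
  then show ?thesis using assms(2) by (auto simp: eventually_nhds)
qed

lemma partial_eq_0_outside:
  assumes "closed S" "\<And>y. y \<notin> S \<Longrightarrow> f y = 0" "x \<notin> S"
  shows "partial i f x = 0"
proof -
  have "\<forall>\<^sub>F t in nhds 0. f (x + t *\<^sub>R axis i 1) = 0"
    using eventually_axis_notin_closed[OF assms(1,3), of i] by eventually_elim (simp add: assms(2))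
  then have "((\<lambda>t. f (x + t *\<^sub>R axis i 1)) has_vector_derivative 0) (at 0)"
    using has_vector_derivative_cong_ev[of UNIV "\<lambda>t. f (x + t *\<^sub>R axis i 1)" "\<lambda>_. 0" 0 0] assms(2,3) by simp
  then show ?thesis by (simp add: partial_def vector_derivative_at)
qed

section \<open>Test functions supported away from x' = 0, and the divergence of x' N^(-\<alpha>)
  |f|^p\<close>

locale test_function =
  fixes K :: "'n::finite set" and f :: "real^'n \<Rightarrow> complex"
  assumes f: "f \<in> test_fun K"
begin

definition S where "S = closure {x. f x \<noteq> 0}"

lemma smooth: "smooth_fun f"
  using f by (simp add: test_fun_def)

lemma compact_S: "compact S" and normK_pos: "x \<in> S \<Longrightarrow> 0 < normK K x"
proof -
  show "compact S" using f by (simp add: test_fun_def S_def)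
  assume "x \<in> S"
  then have "normK K x \<noteq> 0" using f by (auto simp: test_fun_def S_def normK_eq_0_iff)
  then show "0 < normK K x" using normK_nonneg[of K x] by linarith
qed

lemma closed_S: "closed S"
  using compact_S by (rule compact_imp_closed)

lemma f_outside: "x \<notin> S \<Longrightarrow> f x = 0"
  using closure_subset[of "{x. f x \<noteq> 0}"] by (auto simp: S_def)

text \<open>Together with \<open>euler_eq_0\<close> this lets the pointwise weighted formulas extend
  to x' = 0, where \<open>powr\<close> and division only take their default values.\<close>

lemma f_eq_0: "normK K x = 0 \<Longrightarrow> f x = 0"
  using f_outside normK_pos by fastforce

lemma partial_outside: "x \<notin> S \<Longrightarrow> partial i f x = 0"
  using partial_eq_0_outside[OF closed_S f_outside] .

lemma euler_outside: "x \<notin> S \<Longrightarrow> euler_op K f x = 0"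
  by (simp add: euler_op_def partial_outside)

lemma euler_eq_0: "normK K x = 0 \<Longrightarrow> euler_op K f x = 0"
  using euler_outside normK_pos by fastforce

lemma continuous_f: "continuous_on A f"
  using smooth[unfolded smooth_fun_def, rule_format, of "[]"] continuous_on_subset by fastforce

lemma continuous_partial: "continuous_on A (partial i f)"
  using smooth[unfolded smooth_fun_def, rule_format, of "[i]"] continuous_on_subset by fastforce

lemma continuous_euler: "continuous_on A (euler_op K f)"
  unfolding euler_op_def by (intro continuous_intros continuous_partial)

text \<open>On the compact support \<open>S\<close> the weight is continuous because
  \<open>normK\<close> is positive there; outside \<open>S\<close> the integrand is zero.\<close>

lemma integrable_weighted:
  assumes "continuous_on UNIV g" "\<And>x. x \<notin> S \<Longrightarrow> g x = 0" "0 < p"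
  shows "integrable lborel (\<lambda>x. norm (g x :: complex) powr p / normK K x powr \<alpha>)"
proof (rule integrable_continuous_on_compact_support[OF compact_S])
  have "continuous_on S g" using assms(1) continuous_on_subset by blast
  then show "continuous_on S (\<lambda>x. norm (g x) powr p / normK K x powr \<alpha>)"
    using assms(3) by (intro continuous_on_divide continuous_on_norm_powr continuous_on_normK_powr)
      (auto dest: normK_pos)
qed (use assms in auto)

lemma integrable_f: "0 < p \<Longrightarrow> integrable lborel (\<lambda>x. norm (f x) powr p / normK K x powr \<alpha>)"
  by (rule integrable_weighted[OF continuous_f f_outside])

lemma integrable_euler:
  "0 < p \<Longrightarrow> integrable lborel (\<lambda>x. norm (euler_op K f x) powr p / normK K x powr \<alpha>)"
  by (rule integrable_weighted[OF continuous_euler euler_outside])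

context
  fixes p \<alpha> :: real
  assumes p: "1 < p"
begin

text \<open>The i-th component of the vector field x' N^(-\<alpha>) |f|^p; \<open>flux'\<close> is
  its derivative in direction i, as given by the product rule.\<close>

definition flux :: "'n \<Rightarrow> real^'n \<Rightarrow> real" where
  "flux i x = x $ i * normK K x powr (-\<alpha>) * norm (f x) powr p"

definition flux' :: "'n \<Rightarrow> real^'n \<Rightarrow> real" where
  "flux' i x = normK K x powr (-\<alpha>) * norm (f x) powr p
     - \<alpha> * (x $ i)\<^sup>2 * normK K x powr (-\<alpha>-2) * norm (f x) powr p
     + x $ i * normK K x powr (-\<alpha>) * (p * norm (f x) powr (p - 2) * Re (f x * cnj (partial i f x)))"

text \<open>Glued from two open sets: N > 0, where every factor is continuous, and the complement of
  \<open>S\<close>, where the flux is zero. They cover the space since N > 0 on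
  \<open>S\<close>.\<close>

lemma continuous_flux: "continuous_on UNIV (flux i)"
proof -
  have "continuous_on {x. 0 < normK K x} (flux i)"
    unfolding flux_def using p
    by (intro continuous_on_mult continuous_on_component continuous_on_id
          continuous_on_normK_powr continuous_on_norm_powr continuous_f) auto
  moreover have "continuous_on (- S) (flux i)"
    by (rule continuous_on_eq[OF continuous_on_const[of _ 0]]) (auto simp: flux_def f_outside)
  ultimately have "continuous_on ({x. 0 < normK K x} \<union> - S) (flux i)"
    using closed_S by (intro continuous_on_open_Un open_normK_pos) auto
  moreover have "{x. 0 < normK K x} \<union> - S = UNIV" using normK_pos by auto
  ultimately show ?thesis by simp
qed

lemma flux_derivative:
  assumes "i \<in> K"
  shows "((\<lambda>t. flux i (x + t *\<^sub>R axis i 1)) has_real_derivative flux' i x) (at 0)"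
proof (cases "0 < normK K x")
  case True
  have N: "((\<lambda>t. normK K (x + t *\<^sub>R axis i 1) powr (-\<alpha>)) has_real_derivative
       (-\<alpha> * normK K x powr (-\<alpha> - 1)) * (x $ i / normK K x)) (at 0)"
    using DERIV_chain2[OF has_real_derivative_powr[of _ "-\<alpha>"] has_real_derivative_normK_axis[OF assms True]] True
    by simp
  have F: "((\<lambda>t. norm (f (x + t *\<^sub>R axis i 1)) powr p) has_real_derivative
       p * norm (f x) powr (p - 2) * Re (f x * cnj (partial i f x))) (at 0)"
    using has_real_derivative_norm_powr[OF has_vector_derivative_partial[OF smooth] p, of x i] by simp
  have X: "((\<lambda>t. (x + t *\<^sub>R axis i 1) $ i) has_real_derivative 1) (at 0)"
    by (auto intro!: derivative_eq_intros simp: axis_def)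
  have e: "normK K x powr (-\<alpha> - 1) / normK K x = normK K x powr (-\<alpha> - 2)"
    using True powr_diff[of "normK K x" "-\<alpha> - 1" 1] by (simp add: diff_diff_eq)
  have "((\<lambda>t. flux i (x + t *\<^sub>R axis i 1)) has_real_derivative
     (1 * normK K x powr (-\<alpha>) + ((-\<alpha> * normK K x powr (-\<alpha> - 1)) * (x $ i / normK K x)) * x $ i) * norm (f x) powr p
     + (p * norm (f x) powr (p - 2) * Re (f x * cnj (partial i f x))) * (x $ i * normK K x powr (-\<alpha>))) (at 0)"
    unfolding flux_def using DERIV_mult[OF DERIV_mult[OF X N] F] by simp
  moreover have "(1 * normK K x powr (-\<alpha>) + ((-\<alpha> * normK K x powr (-\<alpha> - 1)) * (x $ i / normK K x)) * x $ i) * norm (f x) powr p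
     + (p * norm (f x) powr (p - 2) * Re (f x * cnj (partial i f x))) * (x $ i * normK K x powr (-\<alpha>)) = flux' i x"
    unfolding flux'_def e[symmetric] by (simp add: algebra_simps power2_eq_square)
  ultimately show ?thesis by simp
next
  case False
  then have x: "x \<notin> S" using normK_pos by blast
  have "\<forall>\<^sub>F t in nhds 0. flux i (x + t *\<^sub>R axis i 1) = 0"
    using eventually_axis_notin_closed[OF closed_S x, of i]
    by eventually_elim (simp add: flux_def f_outside)
  then have "((\<lambda>t. flux i (x + t *\<^sub>R axis i 1)) has_real_derivative 0) (at 0)"
    using DERIV_cong_ev[of 0 0 "\<lambda>t. flux i (x + t *\<^sub>R axis i 1)" "\<lambda>_. 0"] by simp
  then show ?thesis using x by (simp add: flux'_def f_outside)
qed

text \<open>For p < 2 the factor |f|^(p-2) blows up near zeros of f. Bounding the real part by |f|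
  |partial_i f| raises the exponent to p - 1 > 0, and the majorant \<open>H\<close> is then
  continuous on the compact set \<open>S\<close>.\<close>

lemma flux'_bounded: "\<exists>M. \<forall>x. \<bar>flux' i x\<bar> \<le> M"
proof -
  define H where "H x = normK K x powr (-\<alpha>) * norm (f x) powr p
     + \<bar>\<alpha>\<bar> * (x $ i)\<^sup>2 * normK K x powr (-\<alpha>-2) * norm (f x) powr p
     + \<bar>x $ i\<bar> * normK K x powr (-\<alpha>) * (p * norm (f x) powr (p - 1) * norm (partial i f x))" for x
  have le: "\<bar>flux' i x\<bar> \<le> H x" for x
  proof -
    have "norm (f x) powr (p - 2) * \<bar>Re (f x * cnj (partial i f x))\<bar>
        \<le> norm (f x) powr (p - 2) * (norm (f x) * norm (partial i f x))"
      using abs_Re_le_cmod[of "f x * cnj (partial i f x)"] by (intro mult_left_mono) (auto simp: norm_mult)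
    also have "\<dots> = norm (f x) powr (p - 1) * norm (partial i f x)"
      using powr_add[of "norm (f x)" "p - 2" 1] by (cases "f x = 0") auto
    finally have "\<bar>x $ i\<bar> * normK K x powr (-\<alpha>) * (p * (norm (f x) powr (p - 2) * \<bar>Re (f x * cnj (partial i f x))\<bar>))
       \<le> \<bar>x $ i\<bar> * normK K x powr (-\<alpha>) * (p * (norm (f x) powr (p - 1) * norm (partial i f x)))"
      using p by (intro mult_left_mono) auto
    moreover have "\<bar>flux' i x\<bar> \<le> \<bar>normK K x powr (-\<alpha>) * norm (f x) powr p\<bar>
     + \<bar>\<alpha> * (x $ i)\<^sup>2 * normK K x powr (-\<alpha>-2) * norm (f x) powr p\<bar>
     + \<bar>x $ i * normK K x powr (-\<alpha>) * (p * norm (f x) powr (p - 2) * Re (f x * cnj (partial i f x)))\<bar>"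
      unfolding flux'_def by linarith
    ultimately show ?thesis unfolding H_def using p by (simp add: abs_mult mult.assoc)
  qed
  have "continuous_on S H"
    unfolding H_def using p
    by (intro continuous_on_add continuous_on_mult continuous_on_const continuous_on_rabs continuous_on_power
          continuous_on_component continuous_on_id continuous_on_norm
          continuous_on_normK_powr continuous_on_norm_powr continuous_f continuous_partial normK_pos) auto
  then have "bounded (H ` S)"
    using compact_S compact_continuous_image compact_imp_bounded by blast
  then obtain M where M: "\<And>x. x \<in> S \<Longrightarrow> \<bar>H x\<bar> \<le> M" unfolding bounded_iff by auto
  have "\<bar>flux' i x\<bar> \<le> max M 0" for x
  proof (cases "x \<in> S")
    case True then show ?thesis using M[OF True] le[of x] by linarith
  next
    case False then show ?thesis by (simp add: flux'_def f_outside)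
  qed
  then show ?thesis by blast
qed

lemma bounded_supp_flux: "bounded {x. flux i x \<noteq> 0}"
  by (rule bounded_subset[OF compact_imp_bounded[OF compact_S]]) (use f_outside in \<open>auto simp: flux_def\<close>)

lemma integrable_flux': "i \<in> K \<Longrightarrow> integrable lborel (flux' i)"
  and integral_flux': "i \<in> K \<Longrightarrow> integral\<^sup>L lborel (flux' i) = 0"
proof -
  assume i: "i \<in> K"
  obtain M where M: "\<And>x. \<bar>flux' i x\<bar> \<le> M" using flux'_bounded by blast
  show "integrable lborel (flux' i)"
    by (rule integrable_directional_derivative[OF continuous_flux flux_derivative[OF i] M bounded_supp_flux])
  show "integral\<^sup>L lborel (flux' i) = 0"
    by (rule integral_directional_derivative[OF continuous_flux flux_derivative[OF i] M bounded_supp_flux])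
qed

text \<open>The divergence of the flux. Each coordinate contributes 1 from x_i, giving k; the
  identity \<open>normK_power2\<close> collapses the derivatives of the weight to -\<alpha>
  N^(-\<alpha>); the derivatives of |f|^p assemble into the Euler operator.\<close>

lemma sum_flux':
  "(\<Sum>i\<in>K. flux' i x) = (real (card K) - \<alpha>) * (norm (f x) powr p / normK K x powr \<alpha>)
     + p * (norm (f x) powr (p - 2) * Re (f x * cnj (euler_op K f x)) / normK K x powr \<alpha>)"
proof (cases "normK K x = 0")
  case True
  then show ?thesis by (simp add: flux'_def f_eq_0)
next
  case False
  then have pos: "0 < normK K x" using normK_nonneg[of K x] by linarith
  have "(\<Sum>i\<in>K. flux' i x) = real (card K) * (normK K x powr (-\<alpha>) * norm (f x) powr p)
     - \<alpha> * ((\<Sum>i\<in>K. (x $ i)\<^sup>2) * normK K x powr (-\<alpha>-2)) * norm (f x) powr p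
     + normK K x powr (-\<alpha>) * p * norm (f x) powr (p - 2) * (\<Sum>i\<in>K. x $ i * Re (f x * cnj (partial i f x)))"
    unfolding flux'_def
    by (simp add: sum.distrib sum_subtractf sum_distrib_left sum_distrib_right mult_ac)
  also have "(\<Sum>i\<in>K. (x $ i)\<^sup>2) * normK K x powr (-\<alpha>-2) = normK K x powr (-\<alpha>)"
    unfolding normK_power2[symmetric] using pos powr_add[of "normK K x" "-\<alpha>-2" 2] by (simp add: mult.commute)
  also have "(\<Sum>i\<in>K. x $ i * Re (f x * cnj (partial i f x))) = Re (f x * cnj (euler_op K f x))"
    unfolding euler_op_def by (simp add: sum_distrib_left sum.distrib algebra_simps)
  finally show ?thesis by (simp add: powr_minus divide_inverse algebra_simps del: times_complex.simps)
qed

lemma integrable_cross: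
  "integrable lborel (\<lambda>x. norm (f x) powr (p - 2) * Re (f x * cnj (euler_op K f x)) / normK K x powr \<alpha>)"
proof -
  have "integrable lborel (\<lambda>x. ((\<Sum>i\<in>K. flux' i x)
      - (real (card K) - \<alpha>) * (norm (f x) powr p / normK K x powr \<alpha>)) / p)"
    using p by (intro integrable_divide Bochner_Integration.integrable_diff Bochner_Integration.integrable_sum
      integrable_flux' integrable_mult_right integrable_f) auto
  then show ?thesis using p by (simp add: sum_flux')
qed

text \<open>Integrate \<open>sum_flux'\<close>: every \<open>flux'\<close> with index in
  \<open>K\<close> has integral zero.\<close>

lemma integral_cross:
  "p * (\<integral>x. norm (f x) powr (p - 2) * Re (f x * cnj (euler_op K f x)) / normK K x powr \<alpha> \<partial>lborel)
    = - (real (card K) - \<alpha>) * (\<integral>x. norm (f x) powr p / normK K x powr \<alpha> \<partial>lborel)"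
proof -
  have "(\<integral>x. (\<Sum>i\<in>K. flux' i x) \<partial>lborel) = 0"
    by (simp add: Bochner_Integration.integral_sum integrable_flux' integral_flux')
  moreover have "(\<integral>x. (\<Sum>i\<in>K. flux' i x) \<partial>lborel)
     = (real (card K) - \<alpha>) * (\<integral>x. norm (f x) powr p / normK K x powr \<alpha> \<partial>lborel)
       + p * (\<integral>x. norm (f x) powr (p - 2) * Re (f x * cnj (euler_op K f x)) / normK K x powr \<alpha> \<partial>lborel)"
    unfolding sum_flux' using p integrable_f[of p \<alpha>] integrable_cross
    by (simp del: times_complex.simps times_divide_eq_right)
  ultimately show ?thesis by (simp only: mult_minus_left)
qed

end

end

text \<open>Here \<xi> - \<eta> = -c \<zeta>. With A = |c \<zeta>| the quadratic part of the last
  term of \<open>Cp\<close> is p A^(p-2) A^2 = p A^p, which with -A^p leaves (p - 1) A^p; the rest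
  is the cross term.\<close>

lemma Cp_add_scaled:
  "Cp p \<xi> (\<xi> + complex_of_real c * \<zeta>) = norm \<xi> powr p + (p - 1) * (\<bar>c\<bar> powr p * norm \<zeta> powr p)
     + p * (c * \<bar>c\<bar> powr (p - 2)) * (norm \<zeta> powr (p - 2) * Re (\<zeta> * cnj \<xi>))"
proof (cases "c = 0 \<or> \<zeta> = 0")
  case True
  then show ?thesis by (auto simp: Cp_altdef)
next
  case False
  define A where "A = \<bar>c\<bar> * norm \<zeta>"
  have A: "0 < A" using False by (simp add: A_def)
  have pw: "A powr q = \<bar>c\<bar> powr q * norm \<zeta> powr q" for q
    by (simp add: A_def powr_mult)
  have A2: "A powr (p - 2) * A\<^sup>2 = A powr p"
    using powr_add[of A "p - 2" 2] A by simp
  have diff: "\<xi> - (\<xi> + complex_of_real c * \<zeta>) = - (complex_of_real c * \<zeta>)" by simp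
  have "A\<^sup>2 = c\<^sup>2 * ((Re \<zeta>)\<^sup>2 + (Im \<zeta>)\<^sup>2)"
    by (simp add: A_def power_mult_distrib cmod_power2)
  then have "Re (- (complex_of_real c * \<zeta>) * cnj (\<xi> + complex_of_real c * \<zeta>)) = - c * Re (\<zeta> * cnj \<xi>) - A\<^sup>2"
    by (simp add: power2_eq_square algebra_simps)
  then have "Cp p \<xi> (\<xi> + complex_of_real c * \<zeta>) = norm \<xi> powr p - A powr p
      - p * A powr (p - 2) * (- c * Re (\<zeta> * cnj \<xi>) - A\<^sup>2)"
    unfolding Cp_altdef diff by (simp add: norm_mult A_def)
  also have "\<dots> = norm \<xi> powr p + (p - 1) * A powr p + p * c * A powr (p - 2) * Re (\<zeta> * cnj \<xi>)"
    unfolding A2[symmetric] by (simp add: algebra_simps del: times_complex.simps)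
  finally show ?thesis unfolding pw by (simp add: mult_ac del: times_complex.simps)
qed

lemma norm_divide_weight_powr:
  assumes "p \<noteq> 0"
  shows "norm (z / complex_of_real (normK K x powr (\<alpha> / p))) powr p = norm z powr p / normK K x powr \<alpha>"
  using assms by (simp add: norm_divide powr_divide powr_powr)

section \<open>The integral of the remainder\<close>

context test_function
begin

context
  fixes p \<alpha> :: real
  assumes p: "1 < p"
begin

definition remainder where
  "remainder x = Cp p (euler_op K f x / complex_of_real (normK K x powr (\<alpha> / p)))
                 (euler_op K f x / complex_of_real (normK K x powr (\<alpha> / p))
                  + complex_of_real ((real (card K) - \<alpha>) / p)
                    * (f x / complex_of_real (normK K x powr (\<alpha> / p))))"

text \<open>Apply \<open>Cp_add_scaled\<close> to the quotients by w = N^(\<alpha>/p). Every term is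
  homogeneous of degree p, so w leaves as w^p = N^\<alpha>; in the cross term this combines w^(p-2)
  with w^2.\<close>

lemma remainder_eq:
  defines "c \<equiv> (real (card K) - \<alpha>) / p"
  shows "remainder x = norm (euler_op K f x) powr p / normK K x powr \<alpha>
     + (p - 1) * \<bar>c\<bar> powr p * (norm (f x) powr p / normK K x powr \<alpha>)
     + p * (c * \<bar>c\<bar> powr (p - 2)) * (norm (f x) powr (p - 2) * Re (f x * cnj (euler_op K f x)) / normK K x powr \<alpha>)"
proof (cases "normK K x = 0")
  case True
  then show ?thesis by (simp add: remainder_def f_eq_0 euler_eq_0)
next
  case False
  define w where "w = normK K x powr (\<alpha> / p)"
  have w: "0 < w" using False by (simp add: w_def)
  have wp: "w powr p = normK K x powr \<alpha>" using p by (simp add: w_def powr_powr)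
  have w2: "w powr (p - 2) * w\<^sup>2 = w powr p"
    using powr_add[of w "p - 2" 2] w by simp
  have re: "Re (f x / complex_of_real w * cnj (euler_op K f x / complex_of_real w))
      = Re (f x * cnj (euler_op K f x)) / w\<^sup>2"
    by (simp add: power2_eq_square field_simps)
  have "norm (f x / complex_of_real w) powr (p - 2)
       * Re (f x / complex_of_real w * cnj (euler_op K f x / complex_of_real w))
     = norm (f x) powr (p - 2) * Re (f x * cnj (euler_op K f x)) / w powr p"
    unfolding re w2[symmetric] using w by (simp add: norm_divide powr_divide del: times_complex.simps)
  then show ?thesis
    unfolding remainder_def w_def[symmetric] Cp_add_scaled wp[symmetric] c_def
    using w by (simp add: norm_divide powr_divide mult.assoc del: times_complex.simps)
qed

text \<open>\<open>integral_cross\<close> turns the cross term into -p |c|^p times the integral of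
  |f|^p N^(-\<alpha>); added to the coefficient (p - 1) |c|^p this leaves -|c|^p.\<close>

lemma
  defines "c \<equiv> (real (card K) - \<alpha>) / p"
  shows integrable_remainder: "integrable lborel remainder"
    and integral_remainder: "integral\<^sup>L lborel remainder
      = (\<integral>x. norm (euler_op K f x) powr p / normK K x powr \<alpha> \<partial>lborel)
        - \<bar>c\<bar> powr p * (\<integral>x. norm (f x) powr p / normK K x powr \<alpha> \<partial>lborel)"
proof -
  let ?I = "\<integral>x. norm (f x) powr p / normK K x powr \<alpha> \<partial>lborel"
  let ?A = "\<integral>x. norm (euler_op K f x) powr p / normK K x powr \<alpha> \<partial>lborel"
  let ?J = "\<integral>x. norm (f x) powr (p - 2) * Re (f x * cnj (euler_op K f x)) / normK K x powr \<alpha> \<partial>lborel"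
  have p0: "0 < p" using p by simp
  note ints = integrable_f[OF p0, of \<alpha>] integrable_euler[OF p0, of \<alpha>] integrable_cross[OF p, of \<alpha>]
  have rem: "remainder = (\<lambda>x. norm (euler_op K f x) powr p / normK K x powr \<alpha>
     + (p - 1) * \<bar>c\<bar> powr p * (norm (f x) powr p / normK K x powr \<alpha>)
     + p * (c * \<bar>c\<bar> powr (p - 2)) * (norm (f x) powr (p - 2) * Re (f x * cnj (euler_op K f x)) / normK K x powr \<alpha>))"
    using remainder_eq unfolding c_def by auto
  show "integrable lborel remainder"
    unfolding rem by (intro Bochner_Integration.integrable_add integrable_mult_right ints)
  have "integral\<^sup>L lborel remainder = ?A + (p - 1) * \<bar>c\<bar> powr p * ?I + p * (c * \<bar>c\<bar> powr (p - 2)) * ?J"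
    unfolding rem using ints
    by (simp del: times_complex.simps times_divide_eq_right)
  also have "p * (c * \<bar>c\<bar> powr (p - 2)) * ?J = (c * \<bar>c\<bar> powr (p - 2)) * (p * ?J)"
    by simp
  also have "p * ?J = - (p * c) * ?I"
    unfolding integral_cross[OF p] c_def using p by simp
  also have "(c * \<bar>c\<bar> powr (p - 2)) * (- (p * c) * ?I) = - p * (\<bar>c\<bar> powr (p - 2) * c\<^sup>2) * ?I"
    by (simp add: power2_eq_square)
  also have "\<bar>c\<bar> powr (p - 2) * c\<^sup>2 = \<bar>c\<bar> powr p"
    using powr_add[of "\<bar>c\<bar>" "p - 2" 2] by (cases "c = 0") auto
  finally show "integral\<^sup>L lborel remainder = ?A - \<bar>c\<bar> powr p * ?I"
    by (simp add: algebra_simps)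
qed

lemma remainder_nonneg: "0 \<le> remainder x"
  unfolding remainder_def by (rule Cp_nonneg[OF p])

lemma integral_remainder_nonneg: "0 \<le> integral\<^sup>L lborel remainder"
  by (simp add: remainder_nonneg)

text \<open>Strict positivity of \<open>Cp\<close> forces its second argument to vanish. The result
  is Euler's equation for homogeneity of degree -c in x', the equality case described in
  (iii).\<close>

lemma remainder_eq_0D:
  assumes "remainder x = 0"
  shows "euler_op K f x = - complex_of_real ((real (card K) - \<alpha>) / p) * f x"
proof (cases "normK K x = 0")
  case True
  then show ?thesis by (simp add: f_eq_0 euler_eq_0)
next
  case False
  have "euler_op K f x / complex_of_real (normK K x powr (\<alpha> / p))
                  + complex_of_real ((real (card K) - \<alpha>) / p)
                    * (f x / complex_of_real (normK K x powr (\<alpha> / p))) = 0"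
    using assms Cp_pos[OF p] unfolding remainder_def by (metis less_irrefl)
  then have "(euler_op K f x + complex_of_real ((real (card K) - \<alpha>) / p) * f x) / complex_of_real (normK K x powr (\<alpha> / p)) = 0"
    by (simp add: add_divide_distrib)
  then show ?thesis using False by (simp add: eq_neg_iff_add_eq_0)
qed

end

section \<open>The inequality and strict positivity of the remainder integral\<close>

lemma hardy_inequality:
  assumes "1 < p"
  shows "\<bar>(real (card K) - \<alpha>) / p\<bar> powr p * (\<integral>x. norm (f x) powr p / normK K x powr \<alpha> \<partial>lborel)
       \<le> (\<integral>x. norm (euler_op K f x) powr p / normK K x powr \<alpha> \<partial>lborel)"
  using integral_remainder[OF assms, of \<alpha>] integral_remainder_nonneg[OF assms, of \<alpha>] by linarith

text \<open>A zero integral would make the open set where f does not vanish a null set, hence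
  empty.\<close>

lemma integral_f_pos:
  assumes "f \<noteq> (\<lambda>_. 0)" "0 < p"
  shows "0 < (\<integral>x. norm (f x) powr p / normK K x powr \<alpha> \<partial>lborel)"
proof (rule ccontr)
  assume "\<not> ?thesis"
  moreover have "0 \<le> (\<integral>x. norm (f x) powr p / normK K x powr \<alpha> \<partial>lborel)" by simp
  ultimately have "(\<integral>x. norm (f x) powr p / normK K x powr \<alpha> \<partial>lborel) = 0" by linarith
  then have "AE x in lborel. norm (f x) powr p / normK K x powr \<alpha> = 0"
    using integral_nonneg_eq_0_iff_AE[OF integrable_f[OF assms(2), of \<alpha>]] by simp
  then have "AE x in lborel. x \<notin> {x. f x \<noteq> 0}"
    by eventually_elim (auto simp: f_eq_0)
  moreover have op: "open {x. f x \<noteq> 0}"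
    by (intro open_Collect_neq continuous_f continuous_intros)
  ultimately have "{x. f x \<noteq> 0} \<in> null_sets lborel"
    by (subst AE_iff_null_sets) auto
  then have "negligible {x. f x \<noteq> 0}"
    by (simp add: negligible_iff_null_sets null_sets_completionI)
  then have "{x. f x \<noteq> 0} = {}"
    using op open_not_negligible by blast
  then show False using assms(1) by auto
qed

text \<open>If the integral were zero, then E f = -c f almost everywhere, so |E f| = |c| |f| for
  every choice of weight. The inequality for another weight exponent has a larger constant and
  contradicts this, without solving the equation for f.\<close>

lemma integral_remainder_pos:
  assumes "f \<noteq> (\<lambda>_. 0)" "1 < p"
  shows "0 < integral\<^sup>L lborel (remainder p \<alpha>)"
proof (rule ccontr)
  define c where "c = (real (card K) - \<alpha>) / p"
  \<comment> \<open>Chosen so that (k - \<beta>)/p = -(|c| + 1), whose absolute value exceeds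
    |c|.\<close>
  define \<beta> where "\<beta> = real (card K) + p * (\<bar>c\<bar> + 1)"
  let ?I = "\<integral>x. norm (f x) powr p / normK K x powr \<beta> \<partial>lborel"
  assume "\<not> ?thesis"
  then have "integral\<^sup>L lborel (remainder p \<alpha>) = 0"
    using integral_remainder_nonneg[OF assms(2), of \<alpha>] by linarith
  then have "AE x in lborel. remainder p \<alpha> x = 0"
    using integral_nonneg_eq_0_iff_AE[OF integrable_remainder[OF assms(2)]] remainder_nonneg[OF assms(2)]
    by auto
  then have "AE x in lborel. norm (euler_op K f x) powr p / normK K x powr \<beta>
      = \<bar>c\<bar> powr p * (norm (f x) powr p / normK K x powr \<beta>)"
  proof eventually_elim
    case (elim x)
    have "norm (euler_op K f x) = \<bar>c\<bar> * norm (f x)"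
      unfolding remainder_eq_0D[OF assms(2) elim] c_def[symmetric] by (simp add: norm_mult)
    then show ?case by (simp add: powr_mult)
  qed
  moreover have p0: "0 < p" using assms(2) by simp
  note ints = integrable_f[OF p0, of \<beta>] integrable_euler[OF p0, of \<beta>]
  ultimately have "(\<integral>x. norm (euler_op K f x) powr p / normK K x powr \<beta> \<partial>lborel)
      = (\<integral>x. \<bar>c\<bar> powr p * (norm (f x) powr p / normK K x powr \<beta>) \<partial>lborel)"
    by (intro integral_cong_AE) (use ints in \<open>auto intro!: borel_measurable_integrable integrable_mult_right simp del: times_divide_eq_right\<close>)
  also have "\<dots> = \<bar>c\<bar> powr p * ?I" by (simp del: times_divide_eq_right)
  finally have "\<bar>(real (card K) - \<beta>) / p\<bar> powr p * ?I \<le> \<bar>c\<bar> powr p * ?I"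
    using hardy_inequality[OF assms(2), of \<beta>] by simp
  moreover have "(real (card K) - \<beta>) / p = - (\<bar>c\<bar> + 1)"
    using p0 by (simp add: \<beta>_def)
  ultimately have "(\<bar>c\<bar> + 1) powr p * ?I \<le> \<bar>c\<bar> powr p * ?I" by (simp add: add.commute)
  then have "(\<bar>c\<bar> + 1) powr p \<le> \<bar>c\<bar> powr p"
    using integral_f_pos[OF assms(1) p0, of \<beta>] by simp
  moreover have "\<bar>c\<bar> powr p < (\<bar>c\<bar> + 1) powr p"
    using p0 by (intro powr_less_mono2) auto
  ultimately show False by simp
qed

end

section \<open>Smooth functions\<close>

lemma power_div_fact_le_exp:
  fixes y :: real
  assumes "0 \<le> y"
  shows "y ^ n / fact n \<le> exp y"
proof -
  have "(\<Sum>k\<in>{n}. y ^ k /\<^sub>R fact k) \<le> (\<Sum>k. y ^ k /\<^sub>R fact k)"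
    using assms by (intro sum_le_suminf summable_exp_generic) auto
  then show ?thesis by (simp add: exp_def divide_inverse mult.commute)
qed

text \<open>\<open>flat 0\<close> is the standard smooth function exp(-1/s) extended by zero. The
  powers of 1/s are indexed because its derivatives are combinations of members of this
  family.\<close>

definition flat :: "nat \<Rightarrow> real \<Rightarrow> real" where
  "flat k s = (if 0 < s then inverse s ^ k * exp (- inverse s) else 0)"

lemma flat_nonneg [simp]: "0 \<le> flat k s"
  by (simp add: flat_def)

lemma flat_eq_0 [simp]: "s \<le> 0 \<Longrightarrow> flat k s = 0"
  by (simp add: flat_def)

lemma flat_le_fact: "flat k s \<le> fact k"
proof (cases "0 < s")
  case True
  then have "inverse s ^ k \<le> fact k * exp (inverse s)"
    using power_div_fact_le_exp[of "inverse s" k] by (simp add: pos_divide_le_eq mult.commute)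
  then have "inverse s ^ k * exp (- inverse s) \<le> fact k * exp (inverse s) * exp (- inverse s)"
    by (intro mult_right_mono) auto
  then show ?thesis using True by (simp add: flat_def exp_minus field_simps)
qed (simp add: flat_def)

lemma flat_Suc: "flat (Suc k) s = flat k s * inverse s"
  by (simp add: flat_def)

text \<open>For s > 0 write \<open>flat k s\<close> as s times \<open>flat (Suc k) s\<close> and
  bound the latter by a factorial. This gives the decay at 0 needed for the derivative
  there.\<close>

lemma flat_le: "\<bar>flat k s\<bar> \<le> fact (Suc k) * \<bar>s\<bar>"
proof (cases "0 < s")
  case True
  then have "flat k s = flat (Suc k) s * s" by (simp add: flat_Suc)
  also have "\<dots> \<le> fact (Suc k) * s" using True flat_le_fact[of "Suc k" s] by (intro mult_right_mono) auto
  finally show ?thesis using True by simp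
qed (simp add: flat_def mult_nonneg_nonpos del: fact_Suc)

lemma has_real_derivative_flat:
  "(flat k has_real_derivative flat (k + 2) s - real k * flat (k + 1) s) (at s)"
proof -
  consider "0 < s" | "s < 0" | "s = 0" by linarith
  then show ?thesis
  proof cases
    case 1
    have "((\<lambda>s. inverse s ^ k * exp (- inverse s)) has_real_derivative
        flat (k + 2) s - real k * flat (k + 1) s) (at s)"
    proof -
      have "((\<lambda>y. y ^ k * exp (- y)) has_real_derivative
          real k * inverse s ^ (k - 1) * exp (- inverse s) - inverse s ^ k * exp (- inverse s)) (at (inverse s))"
        by (auto intro!: derivative_eq_intros)
      from DERIV_chain2[OF this DERIV_inverse[of s]] 1
      have "((\<lambda>s. inverse s ^ k * exp (- inverse s)) has_real_derivative
          (real k * inverse s ^ (k - 1) * exp (- inverse s) - inverse s ^ k * exp (- inverse s))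
            * - (inverse s)\<^sup>2) (at s)" by (simp add: power2_eq_square)
      moreover have "(real k * inverse s ^ (k - 1) * exp (- inverse s) - inverse s ^ k * exp (- inverse s))
            * - (inverse s)\<^sup>2 = flat (k + 2) s - real k * flat (k + 1) s"
        \<comment> \<open>For k = 0 the exponent k - 1 is truncated, but its term carries the factor
          \<open>real k\<close>.\<close>
        using 1 by (cases k) (simp_all add: flat_def algebra_simps power2_eq_square)
      ultimately show ?thesis by simp
    qed
    moreover have ev: "\<forall>\<^sub>F x in nhds s. inverse x ^ k * exp (- inverse x) = flat k x"
      using eventually_nhds_in_open[of "{0<..}" s] 1 by (auto elim!: eventually_mono simp: flat_def)
    ultimately show ?thesis unfolding DERIV_cong_ev[OF refl ev refl] by blast
  next
    case 2
    have "\<forall>\<^sub>F x in nhds s. 0 = flat k x"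
      using eventually_nhds_in_open[of "{..<0}" s] 2 by (auto elim!: eventually_mono simp: flat_def)
    then show ?thesis using DERIV_cong_ev[of s s "\<lambda>_. 0" "flat k" 0 0] 2 by simp
  next
    case 3
    \<comment> \<open>At 0 the difference quotient of \<open>flat k\<close> is
      \<open>flat (Suc k) h\<close>, which is at most (k+2)! |h|.\<close>
    have "((\<lambda>h. fact (Suc (Suc k)) * \<bar>h\<bar>) \<longlongrightarrow> fact (Suc (Suc k)) * \<bar>0\<bar>) (at (0::real))"
      by (intro tendsto_intros)
    then have lim: "((\<lambda>h. fact (Suc (Suc k)) * \<bar>h\<bar>) \<longlongrightarrow> 0) (at (0::real))" by simp
    have "((\<lambda>h. flat k h / h) \<longlongrightarrow> 0) (at 0)"
    proof (rule Lim_null_comparison[OF always_eventually lim], rule allI)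
      fix h :: real
      show "norm (flat k h / h) \<le> fact (Suc (Suc k)) * \<bar>h\<bar>"
        using flat_le[of "Suc k" h] by (simp add: flat_Suc divide_inverse)
    qed
    then show ?thesis using 3 by (simp add: DERIV_def)
  qed
qed

text \<open>Functions with continuous coordinate derivatives up to order m. The derivatives are
  existentially quantified instead of given by \<open>partial\<close>, so closure properties follow
  by induction on m and can be proved on subsets \<open>U\<close> before gluing.\<close>

fun Ck :: "nat \<Rightarrow> (real^'n::finite) set \<Rightarrow> (real^'n \<Rightarrow> 'b::real_normed_vector) \<Rightarrow> bool" where
  "Ck 0 U f \<longleftrightarrow> continuous_on U f"
| "Ck (Suc m) U f \<longleftrightarrow> continuous_on U f \<and>
     (\<forall>i. \<exists>g. Ck m U g \<and> (\<forall>x\<in>U. ((\<lambda>t. f (x + t *\<^sub>R axis i 1)) has_vector_derivative g x) (at 0)))"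

lemma Ck_SucI:
  assumes "continuous_on U f" and "\<And>i. Ck m U (g i)"
    and "\<And>i x. x \<in> U \<Longrightarrow> ((\<lambda>t. f (x + t *\<^sub>R axis i 1)) has_vector_derivative g i x) (at 0)"
  shows "Ck (Suc m) U f"
  using assms by auto

lemma Ck_SucE:
  assumes "Ck (Suc m) U f"
  obtains g where "continuous_on U f" "\<And>i. Ck m U (g i)"
    "\<And>i x. x \<in> U \<Longrightarrow> ((\<lambda>t. f (x + t *\<^sub>R axis i 1)) has_vector_derivative g i x) (at 0)"
proof -
  have "\<exists>g. \<forall>i. Ck m U (g i) \<and> (\<forall>x\<in>U. ((\<lambda>t. f (x + t *\<^sub>R axis i 1)) has_vector_derivative g i x) (at 0))"
    using assms by (intro choice) simp
  then show ?thesis using that assms by auto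
qed

lemma Ck_Suc_imp: "Ck (Suc m) U f \<Longrightarrow> Ck m U f"
proof (induction m arbitrary: f)
  case (Suc m)
  from Suc.prems obtain g where g: "continuous_on U f" "\<And>i. Ck (Suc m) U (g i)"
    "\<And>i x. x \<in> U \<Longrightarrow> ((\<lambda>t. f (x + t *\<^sub>R axis i 1)) has_vector_derivative g i x) (at 0)"
    by (rule Ck_SucE) blast
  show ?case by (rule Ck_SucI[of U f m g]) (use g Suc.IH in auto)
qed auto

lemma Ck_const: "Ck m U (\<lambda>_. c)"
proof (induction m arbitrary: c)
  case (Suc m)
  show ?case by (rule Ck_SucI[of _ _ _ "\<lambda>_ _. 0"]) (use Suc in auto)
qed auto

lemma Ck_component: "Ck m U (\<lambda>x. x $ j)"
proof (cases m)
  case (Suc l)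
  have "((\<lambda>t. (x + t *\<^sub>R axis i 1) $ j) has_vector_derivative (if i = j then 1 else 0)) (at 0)" for i and x :: "real^'a"
    unfolding has_real_derivative_iff_has_vector_derivative[symmetric]
    by (auto intro!: derivative_eq_intros simp: axis_def)
  then show ?thesis unfolding Suc
    by (intro Ck_SucI[of _ _ _ "\<lambda>i _. if i = j then 1 else 0"] Ck_const) (auto intro!: continuous_intros)
qed (auto intro!: continuous_intros)

lemma Ck_add: "Ck m U f \<Longrightarrow> Ck m U g \<Longrightarrow> Ck m U (\<lambda>x. f x + g x)"
proof (induction m arbitrary: f g)
  case (Suc m)
  from Suc.prems(1) obtain f' where f: "continuous_on U f" "\<And>i. Ck m U (f' i)"
    "\<And>i x. x \<in> U \<Longrightarrow> ((\<lambda>t. f (x + t *\<^sub>R axis i 1)) has_vector_derivative f' i x) (at 0)" by (rule Ck_SucE) blast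
  from Suc.prems(2) obtain g' where g: "continuous_on U g" "\<And>i. Ck m U (g' i)"
    "\<And>i x. x \<in> U \<Longrightarrow> ((\<lambda>t. g (x + t *\<^sub>R axis i 1)) has_vector_derivative g' i x) (at 0)" by (rule Ck_SucE) blast
  show ?case
    by (rule Ck_SucI[of _ _ _ "\<lambda>i x. f' i x + g' i x"])
       (use f g Suc.IH in \<open>auto intro!: continuous_intros has_vector_derivative_add\<close>)
qed (auto intro!: continuous_intros)

lemma Ck_mult:
  fixes f g :: "real^'n::finite \<Rightarrow> real"
  shows "Ck m U f \<Longrightarrow> Ck m U g \<Longrightarrow> Ck m U (\<lambda>x. f x * g x)"
proof (induction m arbitrary: f g)
  case (Suc m)
  from Suc.prems(1) obtain f' where f: "continuous_on U f" "\<And>i. Ck m U (f' i)"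
    "\<And>i x. x \<in> U \<Longrightarrow> ((\<lambda>t. f (x + t *\<^sub>R axis i 1)) has_vector_derivative f' i x) (at 0)" by (rule Ck_SucE) blast
  from Suc.prems(2) obtain g' where g: "continuous_on U g" "\<And>i. Ck m U (g' i)"
    "\<And>i x. x \<in> U \<Longrightarrow> ((\<lambda>t. g (x + t *\<^sub>R axis i 1)) has_vector_derivative g' i x) (at 0)" by (rule Ck_SucE) blast
  note fg = Suc.prems[THEN Ck_Suc_imp]
  show ?case
  proof (rule Ck_SucI[of _ _ _ "\<lambda>i x. f x * g' i x + f' i x * g x"])
    show "continuous_on U (\<lambda>x. f x * g x)" using f g by (intro continuous_intros)
    show "Ck m U (\<lambda>x. f x * g' i x + f' i x * g x)" for i
      using fg f g Suc.IH by (intro Ck_add) auto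
    show "((\<lambda>t. f (x + t *\<^sub>R axis i 1) * g (x + t *\<^sub>R axis i 1)) has_vector_derivative
        f x * g' i x + f' i x * g x) (at 0)" if "x \<in> U" for i x
      using has_vector_derivative_mult[OF f(3)[OF that] g(3)[OF that], of i i] by simp
  qed
qed (auto intro!: continuous_intros)

lemma Ck_sum: "finite I \<Longrightarrow> (\<And>j. j \<in> I \<Longrightarrow> Ck m U (f j)) \<Longrightarrow> Ck m U (\<lambda>x. \<Sum>j\<in>I. f j x)"
  by (induction I rule: finite_induct) (auto intro: Ck_const Ck_add)

lemma Ck_power:
  fixes f :: "real^'n::finite \<Rightarrow> real"
  shows "Ck m U f \<Longrightarrow> Ck m U (\<lambda>x. f x ^ k)"
  by (induction k) (auto intro: Ck_const Ck_mult)

lemma Ck_diff: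
  fixes f g :: "real^'n::finite \<Rightarrow> real"
  shows "Ck m U f \<Longrightarrow> Ck m U g \<Longrightarrow> Ck m U (\<lambda>x. f x - g x)"
proof -
  assume "Ck m U f" "Ck m U g"
  then have "Ck m U (\<lambda>x. f x + (-1) * g x)" by (intro Ck_add Ck_mult Ck_const)
  then show ?thesis by simp
qed

text \<open>A whole family \<open>h\<close> is composed at once because the derivative of one member
  may involve others, as for \<^const>\<open>flat\<close>.\<close>

lemma Ck_compose_family:
  fixes f :: "real^'n::finite \<Rightarrow> real" and h h' :: "nat \<Rightarrow> real \<Rightarrow> real"
  assumes f: "Ck m U f"
    and der: "\<And>k x. x \<in> U \<Longrightarrow> (h k has_real_derivative h' k (f x)) (at (f x))"
    and step: "\<And>m k. Ck m U f \<Longrightarrow> (\<And>k. Ck m U (\<lambda>x. h k (f x))) \<Longrightarrow> Ck m U (\<lambda>x. h' k (f x))"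
  shows "Ck m U (\<lambda>x. h k (f x))"
proof -
  have cont: "continuous_on U (\<lambda>x. h k (f x))" if "continuous_on U f" for k
    unfolding continuous_on_def
  proof
    fix x assume x: "x \<in> U"
    have "(f \<longlongrightarrow> f x) (at x within U)" using that x by (auto simp: continuous_on_def)
    then show "((\<lambda>x. h k (f x)) \<longlongrightarrow> h k (f x)) (at x within U)"
      by (rule isCont_tendsto_compose[OF DERIV_isCont[OF der[OF x]]])
  qed
  from f show ?thesis
  proof (induction m arbitrary: k)
    case (Suc m)
    from Suc.prems obtain f' where f: "continuous_on U f" "\<And>i. Ck m U (f' i)"
      "\<And>i x. x \<in> U \<Longrightarrow> ((\<lambda>t. f (x + t *\<^sub>R axis i 1)) has_vector_derivative f' i x) (at 0)" by (rule Ck_SucE) blast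
    have fm: "Ck m U f" using Suc.prems by (rule Ck_Suc_imp)
    show ?case
    proof (rule Ck_SucI[of _ _ _ "\<lambda>i x. h' k (f x) * f' i x"])
      show "continuous_on U (\<lambda>x. h k (f x))" using cont f(1) .
      show "Ck m U (\<lambda>x. h' k (f x) * f' i x)" for i
        using fm f(2) Suc.IH by (intro Ck_mult step) auto
      show "((\<lambda>t. h k (f (x + t *\<^sub>R axis i 1))) has_vector_derivative h' k (f x) * f' i x) (at 0)"
        if "x \<in> U" for i x
        using DERIV_chain2[of "h k" "h' k (f x)" "\<lambda>t. f (x + t *\<^sub>R axis i 1)" 0 "f' i x" UNIV]
          der[OF that] f(3)[OF that]
        by (simp add: has_real_derivative_iff_has_vector_derivative)
    qed
  qed (use cont in auto)
qed

lemma Ck_exp: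
  fixes f :: "real^'n::finite \<Rightarrow> real"
  assumes "Ck m U f"
  shows "Ck m U (\<lambda>x. exp (f x))"
  using Ck_compose_family[OF assms, of "\<lambda>_. exp" "\<lambda>_. exp"] by (auto intro: DERIV_exp)

lemma Ck_inverse:
  fixes f :: "real^'n::finite \<Rightarrow> real"
  assumes "Ck m U f" and "\<And>x. x \<in> U \<Longrightarrow> f x \<noteq> 0"
  shows "Ck m U (\<lambda>x. inverse (f x))"
\<comment> \<open>The derivative is spelled as a product of -1 and two copies of
  \<open>inverse\<close>, so that the \<open>step\<close> premise is an instance of
  \<open>Ck_mult\<close> and \<open>Ck_const\<close>.\<close>
proof (rule Ck_compose_family[OF assms(1), of "\<lambda>_. inverse" "\<lambda>_ y. (-1) * (inverse y * inverse y)"])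
  show "(inverse has_real_derivative -1 * (inverse (f x) * inverse (f x))) (at (f x))" if "x \<in> U" for x
    using DERIV_inverse[OF assms(2)[OF that]] by (simp add: power2_eq_square)
qed (intro Ck_mult Ck_const; assumption)

lemma Ck_ln:
  fixes f :: "real^'n::finite \<Rightarrow> real"
  assumes "Ck m U f" and "\<And>x. x \<in> U \<Longrightarrow> 0 < f x"
  shows "Ck m U (\<lambda>x. ln (f x))"
proof (rule Ck_compose_family[OF assms(1), of "\<lambda>_. ln" "\<lambda>_. inverse"])
  show "(ln has_real_derivative inverse (f x)) (at (f x))" if "x \<in> U" for x
    using DERIV_ln[OF assms(2)[OF that]] .
  show "Ck l U (\<lambda>x. inverse (f x))" if "Ck l U f" for l
    using that by (rule Ck_inverse) (use assms(2) in fastforce)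
qed

lemma Ck_flat:
  fixes f :: "real^'n::finite \<Rightarrow> real"
  assumes "Ck m U f"
  shows "Ck m U (\<lambda>x. flat k (f x))"
proof (rule Ck_compose_family[OF assms, of flat "\<lambda>k s. flat (k + 2) s - real k * flat (k + 1) s"])
  show "Ck l U (\<lambda>x. flat (j + 2) (f x) - real j * flat (j + 1) (f x))"
    if "\<And>k. Ck l U (\<lambda>x. flat k (f x))" for l j
    using that by (intro Ck_diff Ck_mult Ck_const)
qed (rule has_real_derivative_flat)

text \<open>Openness of \<open>U\<close> keeps nearby points of each axis line inside
  \<open>U\<close>, so both functions have the same coordinate derivatives there.\<close>

lemma Ck_cong:
  assumes "open U" "\<And>x. x \<in> U \<Longrightarrow> f x = g x" "Ck m U f"
  shows "Ck m U g"
proof (cases m)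
  case 0
  then show ?thesis using assms continuous_on_cong by force
next
  case (Suc l)
  with assms(3) have "Ck (Suc l) U f" by simp
  then obtain f' where f: "continuous_on U f" "\<And>i. Ck l U (f' i)"
    "\<And>i x. x \<in> U \<Longrightarrow> ((\<lambda>t. f (x + t *\<^sub>R axis i 1)) has_vector_derivative f' i x) (at 0)" by (rule Ck_SucE) blast
  show ?thesis unfolding Suc
  proof (rule Ck_SucI[of _ _ _ f'])
    show "continuous_on U g" using f(1) assms(2) continuous_on_cong by force
    fix i x assume x: "x \<in> U"
    have "\<forall>\<^sub>F t in nhds 0. f (x + t *\<^sub>R axis i 1) = g (x + t *\<^sub>R axis i 1)"
      using eventually_axis_notin_closed[of "- U" x i] assms(1,2) x
      by (auto simp: closed_def elim!: eventually_mono)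
    then show "((\<lambda>t. g (x + t *\<^sub>R axis i 1)) has_vector_derivative f' i x) (at 0)"
      using f(3)[OF x, of i] assms(2)[OF x]
        has_vector_derivative_cong_ev[of UNIV "\<lambda>t. f (x + t *\<^sub>R axis i 1)" "\<lambda>t. g (x + t *\<^sub>R axis i 1)" 0 "f' i x"]
      by simp
  qed (rule f)
qed

text \<open>On the overlap the two families of derivatives agree by uniqueness, so the pasted
  derivative \<open>h\<close> is of class m on both pieces and the induction hypothesis applies to
  it.\<close>

lemma Ck_Un:
  assumes "open U" "open V"
  shows "Ck m U f \<Longrightarrow> Ck m V f \<Longrightarrow> Ck m (U \<union> V) f"
proof (induction m arbitrary: f)
  case 0
  then show ?case using assms by (auto intro: continuous_on_open_Un)
next
  case (Suc m)
  from Suc.prems(1) obtain f' where f: "continuous_on U f" "\<And>i. Ck m U (f' i)"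
    "\<And>i x. x \<in> U \<Longrightarrow> ((\<lambda>t. f (x + t *\<^sub>R axis i 1)) has_vector_derivative f' i x) (at 0)" by (rule Ck_SucE) blast
  from Suc.prems(2) obtain g' where g: "continuous_on V f" "\<And>i. Ck m V (g' i)"
    "\<And>i x. x \<in> V \<Longrightarrow> ((\<lambda>t. f (x + t *\<^sub>R axis i 1)) has_vector_derivative g' i x) (at 0)" by (rule Ck_SucE) blast
  define h where "h i x = (if x \<in> U then f' i x else g' i x)" for i x
  have hV: "g' i x = h i x" if "x \<in> V" for i x
    using vector_derivative_unique_at[OF f(3) g(3)] that by (auto simp: h_def)
  show ?case
  proof (rule Ck_SucI[of _ _ _ h])
    show "continuous_on (U \<union> V) f" using assms f(1) g(1) by (intro continuous_on_open_Un)
    show "Ck m (U \<union> V) (h i)" for i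
      by (intro Suc.IH Ck_cong[OF assms(1) _ f(2), of i "h i"] Ck_cong[OF assms(2) hV g(2)])
         (auto simp: h_def)
    show "((\<lambda>t. f (x + t *\<^sub>R axis i 1)) has_vector_derivative h i x) (at 0)" if "x \<in> U \<union> V" for i x
      using that f(3) g(3) by (auto simp: h_def)
  qed
qed

lemma Ck_of_real:
  fixes f :: "real^'n::finite \<Rightarrow> real"
  shows "Ck m U f \<Longrightarrow> Ck m U (\<lambda>x. complex_of_real (f x))"
proof (induction m arbitrary: f)
  case (Suc m)
  from Suc.prems(1) obtain f' where f: "continuous_on U f" "\<And>i. Ck m U (f' i)"
    "\<And>i x. x \<in> U \<Longrightarrow> ((\<lambda>t. f (x + t *\<^sub>R axis i 1)) has_vector_derivative f' i x) (at 0)" by (rule Ck_SucE) blast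
  show ?case
    by (rule Ck_SucI[of _ _ _ "\<lambda>i x. complex_of_real (f' i x)"])
       (use f Suc.IH in \<open>auto intro!: continuous_intros has_vector_derivative_of_real
          simp: has_real_derivative_iff_has_vector_derivative\<close>)
qed (auto intro!: continuous_intros)

lemma Ck_partial:
  assumes "\<And>m. Ck m UNIV f"
  shows "Ck m UNIV (partial i f)"
proof -
  from assms[of "Suc m"] obtain f' where f: "continuous_on UNIV f" "\<And>i. Ck m UNIV (f' i)"
    "\<And>i x. ((\<lambda>t. f (x + t *\<^sub>R axis i 1)) has_vector_derivative f' i x) (at 0)" by (rule Ck_SucE) auto
  have "partial i f = f' i"
    using f(3) by (auto simp: partial_def vector_derivative_at)
  then show ?thesis using f(2) by simp
qed

text \<open>Each \<open>partial\<close> costs one order of differentiability, so the induction over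
  the index list keeps m arbitrary.\<close>

lemma smooth_fun_Ck:
  assumes "\<And>m. Ck m UNIV f"
  shows "smooth_fun f"
proof -
  have *: "Ck m UNIV (iter_partial is f)" for m "is"
    by (induction "is" arbitrary: m) (auto intro: assms Ck_partial)
  have "(\<lambda>t. iter_partial is f (x + t *\<^sub>R axis i 1)) differentiable (at 0)" for "is" i x
    using *[of "Suc 0" "is"] by (auto simp: differentiable_def has_vector_derivative_def)
  then show ?thesis using *[of 0] by (simp add: smooth_fun_def)
qed

section \<open>Dilation invariance of the weighted mass\<close>

definition tail2 :: "'n::finite set \<Rightarrow> real^'n \<Rightarrow> real" where
  "tail2 K x = (\<Sum>j\<in>-K. (x $ j)\<^sup>2)"

text \<open>The radii are given by their logarithms, so that dilating x' by exp r translates both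
  bounds by r.\<close>

definition annulus :: "'n::finite set \<Rightarrow> real \<Rightarrow> real \<Rightarrow> (real^'n) set" where
  "annulus K a b = {x. exp a \<le> normK K x \<and> normK K x \<le> exp b \<and> tail2 K x \<le> 1}"

lemma normK_pos_annulus: "x \<in> annulus K a b \<Longrightarrow> 0 < normK K x"
  unfolding annulus_def using less_le_trans[OF exp_gt_zero[of a]] by auto

lemma continuous_on_tail2: "continuous_on A (tail2 K)"
  unfolding tail2_def by (intro continuous_intros)

lemma norm_power2_split: "(norm x)\<^sup>2 = (normK K x)\<^sup>2 + tail2 K x"
  unfolding norm_vec_def L2_set_def normK_power2 tail2_def
  by (simp add: sum_nonneg sum.subset_diff[of K UNIV] Compl_eq_Diff_UNIV add.commute)

lemma compact_annulus: "compact (annulus K a b)"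
proof -
  have "closed (annulus K a b)"
    unfolding annulus_def
    by (intro closed_Collect_conj closed_Collect_le continuous_on_normK continuous_on_tail2 continuous_on_const)
  moreover have "norm x \<le> exp b + 1" if "x \<in> annulus K a b" for x
  proof (rule power2_le_imp_le)
    have "(normK K x)\<^sup>2 \<le> (exp b)\<^sup>2"
      using that by (intro power_mono) (auto simp: annulus_def)
    moreover have "tail2 K x \<le> 1" using that by (simp add: annulus_def)
    moreover have "(exp b + 1)\<^sup>2 = (exp b)\<^sup>2 + 1 + 2 * exp b" by (simp add: power2_sum)
    ultimately show "(norm x)\<^sup>2 \<le> (exp b + 1)\<^sup>2"
      unfolding norm_power2_split[of x K] using exp_gt_zero[of b] by linarith
  qed simp
  then have "bounded (annulus K a b)" unfolding bounded_iff by blast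
  ultimately show ?thesis by (simp add: compact_eq_bounded_closed)
qed

text \<open>Change of variables for the diagonal map scaling the coordinates in \<open>K\<close> by
  s, with determinant s^k.\<close>

lemma lborel_integral_dilation:
  fixes g :: "real^'n::finite \<Rightarrow> real" and K :: "'n set"
  assumes "g \<in> borel_measurable borel" "0 < s"
  shows "integral\<^sup>L lborel g = s ^ card K * (\<integral>x. g (\<chi> i. if i \<in> K then s * x $ i else x $ i) \<partial>lborel)"
proof -
  \<comment> \<open>\<open>c\<close> gives the diagonal entry belonging to each basis vector. The
    summand 0 in \<open>T\<close> is the translation part expected by
    \<open>lborel_affine_euclidean\<close>.\<close>
  define c :: "real^'n \<Rightarrow> real" where "c j = (if \<exists>i\<in>K. j = axis i 1 then s else 1)" for j
  define T :: "real^'n \<Rightarrow> real^'n" where "T x = 0 + (\<Sum>j\<in>Basis. (c j * (x \<bullet> j)) *\<^sub>R j)" for x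
  have c_axis: "c (axis i 1) = (if i \<in> K then s else 1)" for i
    by (auto simp: c_def axis_eq_axis)
  have T: "T x = (\<chi> i. if i \<in> K then s * x $ i else x $ i)" for x
  proof (rule vec_eq_iff[THEN iffD2], rule allI)
    fix i
    have "axis i 1 \<in> (Basis :: (real^'n) set)" by (simp add: axis_in_Basis_iff)
    then have "T x \<bullet> axis i 1 = c (axis i 1) * (x \<bullet> axis i 1)"
      unfolding T_def by (simp add: inner_sum_left_Basis)
    then show "T x $ i = (\<chi> i. if i \<in> K then s * x $ i else x $ i) $ i"
      by (simp add: inner_axis c_axis)
  qed
  have Tm: "T \<in> borel_measurable borel"
    unfolding T_def by measurable
  have "(\<Prod>j\<in>Basis. \<bar>c j\<bar>) = s ^ card K"
  proof -
    have B: "(Basis :: (real^'n) set) = range (\<lambda>i. axis i 1)"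
      by (auto simp: Basis_vec_def)
    have "(\<Prod>j\<in>Basis. \<bar>c j\<bar>) = (\<Prod>i\<in>UNIV. \<bar>c (axis i 1)\<bar>)"
      unfolding B by (subst prod.reindex) (auto simp: inj_on_def axis_eq_axis)
    also have "\<dots> = (\<Prod>i\<in>UNIV. if i \<in> K then s else 1)"
      using assms(2) by (intro prod.cong) (auto simp: c_axis)
    also have "\<dots> = s ^ card K" by (simp add: prod.If_cases)
    finally show ?thesis .
  qed
  moreover have "c j \<noteq> 0" for j using assms(2) by (simp add: c_def)
  ultimately have "lborel = density (distr lborel borel T) (\<lambda>_. ennreal (s ^ card K))"
    using lborel_affine_euclidean[of c 0] unfolding T_def by simp
  then have "integral\<^sup>L lborel g = integral\<^sup>L (density (distr lborel borel T) (\<lambda>_. ennreal (s ^ card K))) g"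
    by simp
  also have "\<dots> = (\<integral>x. s ^ card K * g x \<partial>distr lborel borel T)"
    using assms by (subst integral_density) auto
  also have "\<dots> = (\<integral>x. s ^ card K * g (T x) \<partial>lborel)"
    using assms Tm by (subst integral_distr) auto
  finally show ?thesis by (simp add: T)
qed

text \<open>The density shared by |F|^p N^(-\<alpha>) and |E F|^p N^(-\<alpha>) for the almost
  extremal F: with c = (k - \<alpha>)/p the powers of N combine to N^(-k), and the cutoff in x''
  enters to the power p.\<close>

definition ann_weight :: "'n::finite set \<Rightarrow> real \<Rightarrow> real^'n \<Rightarrow> real" where
  "ann_weight K p x = normK K x powr (- real (card K)) * flat 0 (1 - tail2 K x) powr p"

lemma ann_weight_nonneg: "0 \<le> ann_weight K p x"
  by (simp add: ann_weight_def)

lemma continuous_on_flat: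
  assumes "continuous_on A g"
  shows "continuous_on A (\<lambda>x. flat k (g x))"
proof -
  have "continuous_on UNIV (flat k)"
    using has_real_derivative_flat DERIV_isCont by (intro continuous_at_imp_continuous_on) blast
  then show ?thesis using assms continuous_on_compose2 by blast
qed

definition ann_mass :: "'n::finite set \<Rightarrow> real \<Rightarrow> real \<Rightarrow> real \<Rightarrow> real" where
  "ann_mass K p a b = (\<integral>x. indicator (annulus K a b) x * ann_weight K p x \<partial>lborel)"

lemma integrable_ann_mass:
  assumes "0 < p"
  shows "integrable lborel (\<lambda>x. indicator (annulus K a b) x * ann_weight K p x)"
proof -
  have "continuous_on (annulus K a b) (\<lambda>x. normK K x powr (- real (card K)) * norm (flat 0 (1 - tail2 K x)) powr p)"
    using assms
    by (intro continuous_on_mult continuous_on_normK_powr continuous_on_norm_powr continuous_on_flat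
        continuous_on_diff continuous_on_const continuous_on_tail2 normK_pos_annulus)
  then have "continuous_on (annulus K a b) (ann_weight K p)"
    by (simp add: ann_weight_def[abs_def])
  then show ?thesis using borel_integrable_compact[OF compact_annulus, of K a b "ann_weight K p"] by simp
qed

text \<open>Dilating x' by exp r multiplies N^(-k) by exp(-r k), which the Jacobian exp(r k)
  cancels; x'' is untouched.\<close>

lemma ann_mass_shift:
  assumes "0 < p"
  shows "ann_mass K p (a + r) (b + r) = ann_mass K p a b"
proof -
  let ?T = "\<lambda>x. (\<chi> i. if i \<in> K then exp r * x $ i else x $ i) :: real^'a"
  let ?g = "\<lambda>x. indicator (annulus K (a + r) (b + r)) x * ann_weight K p x"
  have N: "normK K (?T x) = exp r * normK K x" for x
  proof (rule power2_eq_imp_eq)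
    show "(normK K (?T x))\<^sup>2 = (exp r * normK K x)\<^sup>2"
      unfolding power_mult_distrib normK_power2 by (simp add: sum_distrib_left power_mult_distrib)
  qed auto
  have t: "tail2 K (?T x) = tail2 K x" for x
    unfolding tail2_def by (intro sum.cong) auto
  have A: "?T x \<in> annulus K (a + r) (b + r) \<longleftrightarrow> x \<in> annulus K a b" for x
    unfolding annulus_def mem_Collect_eq N t by (simp add: exp_add mult.commute)
  have e: "exp r powr (- real (card K)) * exp r ^ card K = 1"
    by (simp add: powr_minus powr_realpow)
  have gT: "?g (?T x) = exp r powr (- real (card K)) * (indicator (annulus K a b) x * ann_weight K p x)" for x
    unfolding ann_weight_def N t indicator_def A by (simp add: powr_mult)
  have g: "?g \<in> borel_measurable borel"
    using borel_measurable_integrable[OF integrable_ann_mass[OF assms, of K "a + r" "b + r"]] by simp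
  have "ann_mass K p (a + r) (b + r)
     = exp r ^ card K * (exp r powr (- real (card K)) * ann_mass K p a b)"
    unfolding ann_mass_def lborel_integral_dilation[OF g exp_gt_zero[of r], of K] gT by simp
  then show ?thesis using e by (simp add: mult.commute[of "exp r powr _"] flip: mult.assoc)
qed

text \<open>Cut the large annulus at N = 1; each half is a translate, on the logarithmic scale, of
  the annulus from -R to R. The halves share the set N = 1, so the pointwise comparison is only an
  inequality.\<close>

lemma ann_mass_double:
  assumes "0 < p" "0 \<le> R"
  shows "ann_mass K p (- 2 * R) (2 * R) \<le> 2 * ann_mass K p (- R) R"
proof -
  have "ann_mass K p (- 2 * R) (2 * R) \<le> (\<integral>x. indicator (annulus K (- 2 * R) 0) x * ann_weight K p x
     + indicator (annulus K 0 (2 * R)) x * ann_weight K p x \<partial>lborel)"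
    unfolding ann_mass_def
  proof (rule integral_mono)
    fix x
    show "indicator (annulus K (- 2 * R) (2 * R)) x * ann_weight K p x
      \<le> indicator (annulus K (- 2 * R) 0) x * ann_weight K p x + indicator (annulus K 0 (2 * R)) x * ann_weight K p x"
      using ann_weight_nonneg[of K p x] by (auto simp: indicator_def annulus_def)
  qed (intro integrable_ann_mass assms Bochner_Integration.integrable_add)+
  also have "\<dots> = ann_mass K p (- 2 * R) 0 + ann_mass K p 0 (2 * R)"
    unfolding ann_mass_def by (intro Bochner_Integration.integral_add integrable_ann_mass assms)
  also have "\<dots> = 2 * ann_mass K p (- R) R"
    using ann_mass_shift[OF assms(1), of K "- 2 * R" R 0] ann_mass_shift[OF assms(1), of K 0 "- R" "2 * R"] by simp
  finally show ?thesis .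
qed

section \<open>Almost extremal functions\<close>

text \<open>Either b \<le> \<theta> a or a < b/\<theta>, and the larger summand absorbs the other.
  The point is that the factor of a^p can be made as close to 1 as desired.\<close>

lemma sum_powr_le:
  fixes a b \<theta> p :: real
  assumes "0 \<le> a" "0 \<le> b" "0 < \<theta>" "0 < p"
  shows "(a + b) powr p \<le> (1 + \<theta>) powr p * a powr p + (1 + 1 / \<theta>) powr p * b powr p"
proof (cases "b \<le> \<theta> * a")
  case True
  have "(a + b) powr p \<le> ((1 + \<theta>) * a) powr p"
    using assms True by (intro powr_mono2) (auto simp: algebra_simps)
  also have "\<dots> = (1 + \<theta>) powr p * a powr p" by (rule powr_mult)
  finally show ?thesis by (simp add: add_increasing2)
next
  case False
  have "(a + b) powr p \<le> ((1 + 1 / \<theta>) * b) powr p"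
    using assms False by (intro powr_mono2) (auto simp: field_simps)
  also have "\<dots> = (1 + 1 / \<theta>) powr p * b powr p" by (rule powr_mult)
  finally show ?thesis by (simp add: add_increasing)
qed

text \<open>The power r^(-c) is the formal extremal profile; the bump in \<epsilon> ln r confines it
  to |ln r| < 1/\<epsilon>.\<close>

definition radial :: "real \<Rightarrow> real \<Rightarrow> real \<Rightarrow> real" where
  "radial c \<epsilon> r = r powr (- c) * flat 0 (1 - (\<epsilon> * ln r)\<^sup>2)"

definition almost_ext :: "'n::finite set \<Rightarrow> real \<Rightarrow> real \<Rightarrow> real^'n \<Rightarrow> real" where
  "almost_ext K c \<epsilon> x = radial c \<epsilon> (normK K x) * flat 0 (1 - tail2 K x)"

lemma ln_bounds_iff:
  fixes r \<epsilon> t :: real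
  assumes "0 < r" "0 < \<epsilon>" "0 \<le> t"
  shows "(\<epsilon> * ln r)\<^sup>2 \<le> t\<^sup>2 \<longleftrightarrow> exp (- (t / \<epsilon>)) \<le> r \<and> r \<le> exp (t / \<epsilon>)"
proof -
  have "(\<epsilon> * ln r)\<^sup>2 \<le> t\<^sup>2 \<longleftrightarrow> - t \<le> \<epsilon> * ln r \<and> \<epsilon> * ln r \<le> t"
    unfolding abs_le_square_iff[symmetric] using assms by (auto simp: abs_le_iff simp del: abs_mult)
  also have "\<dots> \<longleftrightarrow> - (t / \<epsilon>) \<le> ln r \<and> ln r \<le> t / \<epsilon>"
    using assms by (auto simp: field_simps)
  also have "\<dots> \<longleftrightarrow> exp (- (t / \<epsilon>)) \<le> r \<and> r \<le> exp (t / \<epsilon>)"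
    using assms by (simp add: ln_ge_iff) (metis exp_le_cancel_iff exp_ln)
  finally show ?thesis .
qed

text \<open>The indices k and l are free because the derivative of the cutoff involves
  \<open>flat 2\<close>.\<close>

lemma flat_cutoff_outside:
  assumes "0 < \<epsilon>" "0 < normK K x" "x \<notin> annulus K (- (1 / \<epsilon>)) (1 / \<epsilon>)"
  shows "flat k (1 - (\<epsilon> * ln (normK K x))\<^sup>2) = 0 \<or> flat l (1 - tail2 K x) = 0"
  using assms ln_bounds_iff[of "normK K x" \<epsilon> 1] by (auto simp: annulus_def not_le)

lemma almost_ext_outside:
  assumes "0 < \<epsilon>" "x \<notin> annulus K (- (1 / \<epsilon>)) (1 / \<epsilon>)"
  shows "almost_ext K c \<epsilon> x = 0"
proof (cases "normK K x = 0")
  case False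
  then have "0 < normK K x" using normK_nonneg[of K x] by linarith
  then show ?thesis
    using flat_cutoff_outside[OF assms(1) _ assms(2)] by (auto simp: almost_ext_def radial_def)
qed (simp add: almost_ext_def radial_def)

text \<open>Where N > 0 the function is composed from smooth ones, with ln N written as half the
  logarithm of the sum of squares; near N = 0 it is identically zero. The two open sets cover the
  space.\<close>

lemma Ck_almost_ext:
  assumes "0 < \<epsilon>"
  shows "Ck m UNIV (almost_ext K c \<epsilon>)"
proof -
  let ?U = "{x. 0 < normK K x}" and ?V = "{x. normK K x < exp (- (1 / \<epsilon>))}"
  have N: "0 < (\<Sum>i\<in>K. (x $ i)\<^sup>2)" if "x \<in> ?U" for x
    using that normK_power2[of K x] by (metis mem_Collect_eq zero_less_power)
  have ck: "Ck m ?U (\<lambda>x. exp (- c * (1 / 2 * ln (\<Sum>i\<in>K. (x $ i)\<^sup>2)))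
      * flat 0 (1 - (\<epsilon> * (1 / 2 * ln (\<Sum>i\<in>K. (x $ i)\<^sup>2)))\<^sup>2) * flat 0 (1 - (\<Sum>j\<in>-K. (x $ j)\<^sup>2)))"
    by (intro Ck_mult Ck_exp Ck_flat Ck_diff Ck_power Ck_const Ck_ln Ck_sum Ck_component N) auto
  have eq: "exp (- c * (1 / 2 * ln (\<Sum>i\<in>K. (x $ i)\<^sup>2)))
      * flat 0 (1 - (\<epsilon> * (1 / 2 * ln (\<Sum>i\<in>K. (x $ i)\<^sup>2)))\<^sup>2) * flat 0 (1 - (\<Sum>j\<in>-K. (x $ j)\<^sup>2))
      = almost_ext K c \<epsilon> x" if "x \<in> ?U" for x
  proof -
    have "1 / 2 * ln (\<Sum>i\<in>K. (x $ i)\<^sup>2) = ln (normK K x)"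
      using that by (simp add: normK_power2[symmetric] ln_realpow)
    then show ?thesis using that unfolding almost_ext_def radial_def tail2_def by (simp add: powr_def)
  qed
  have U: "Ck m ?U (almost_ext K c \<epsilon>)"
    by (rule Ck_cong[OF open_normK_pos eq ck])
  have oV: "open ?V" by (intro open_Collect_less continuous_on_normK continuous_on_const)
  have V: "Ck m ?V (almost_ext K c \<epsilon>)"
    by (rule Ck_cong[OF oV _ Ck_const[of _ _ 0]]) (auto simp: almost_ext_outside[OF assms] annulus_def)
  have "?U \<union> ?V = UNIV" using normK_nonneg[of K] by (auto simp: not_less intro: le_less_trans[OF _ exp_gt_zero])
  then show ?thesis using Ck_Un[OF open_normK_pos oV U V] by simp
qed

lemma almost_ext_test_fun:
  assumes "0 < \<epsilon>"
  shows "(\<lambda>x. complex_of_real (almost_ext K c \<epsilon> x)) \<in> test_fun K"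
proof -
  let ?A = "annulus K (- (1 / \<epsilon>)) (1 / \<epsilon>)"
  have "{x. complex_of_real (almost_ext K c \<epsilon> x) \<noteq> 0} \<subseteq> ?A"
    using almost_ext_outside[OF assms, of _ K c] by auto
  then have sub: "closure {x. complex_of_real (almost_ext K c \<epsilon> x) \<noteq> 0} \<subseteq> ?A"
    using compact_imp_closed[OF compact_annulus] by (intro closure_minimal) auto
  then have "compact (closure {x. complex_of_real (almost_ext K c \<epsilon> x) \<noteq> 0})"
    using compact_annulus bounded_subset compact_eq_bounded_closed closed_closure by metis
  moreover have "smooth_fun (\<lambda>x. complex_of_real (almost_ext K c \<epsilon> x))"
    by (intro smooth_fun_Ck Ck_of_real Ck_almost_ext assms)
  moreover have "closure {x. complex_of_real (almost_ext K c \<epsilon> x) \<noteq> 0} \<inter> {x. \<forall>i\<in>K. x $ i = 0} = {}"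
  proof -
    have "\<not> (\<forall>i\<in>K. x $ i = 0)" if "x \<in> ?A" for x
      using normK_pos_annulus[OF that] normK_eq_0_iff[of K x] by auto
    then show ?thesis using sub by blast
  qed
  ultimately show ?thesis unfolding test_fun_def by blast
qed

lemma has_real_derivative_radial:
  assumes "0 < r"
  shows "(radial c \<epsilon> has_real_derivative
     r powr (- c) / r * (- c * flat 0 (1 - (\<epsilon> * ln r)\<^sup>2) + \<epsilon> * (- 2 * (\<epsilon> * ln r) * flat 2 (1 - (\<epsilon> * ln r)\<^sup>2)))) (at r)"
proof -
  have 1: "((\<lambda>r. r powr (- c)) has_real_derivative - c * r powr (- c - 1)) (at r)"
    using has_real_derivative_powr[OF assms, of "- c"] .
  have "((\<lambda>r. 1 - (\<epsilon> * ln r)\<^sup>2) has_real_derivative - (2 * (\<epsilon> * ln r) * (\<epsilon> / r))) (at r)"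
    using assms by (auto intro!: derivative_eq_intros simp: field_simps power2_eq_square)
  from DERIV_chain2[OF has_real_derivative_flat[of 0] this]
  have 2: "((\<lambda>r. flat 0 (1 - (\<epsilon> * ln r)\<^sup>2)) has_real_derivative
     flat 2 (1 - (\<epsilon> * ln r)\<^sup>2) * - (2 * (\<epsilon> * ln r) * (\<epsilon> / r))) (at r)"
    by (simp add: numeral_2_eq_2)
  have "r powr (- c - 1) = r powr (- c) / r"
    using assms powr_diff[of r "- c" 1] by simp
  then show ?thesis
    using DERIV_mult[OF 1 2] unfolding radial_def by (simp add: algebra_simps)
qed

text \<open>The derivative of N in direction i is x_i/N and \<open>tail2\<close> is constant along
  directions in \<open>K\<close>, so the Euler operator acts as r d/dr on the radial factor.\<close>

lemma euler_almost_ext: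
  fixes c \<epsilon> :: real
  assumes "0 < normK K x"
  defines "u \<equiv> \<epsilon> * ln (normK K x)"
  shows "euler_op K (\<lambda>x. complex_of_real (almost_ext K c \<epsilon> x)) x
     = complex_of_real (normK K x powr (- c) * flat 0 (1 - tail2 K x)
         * (- c * flat 0 (1 - u\<^sup>2) + \<epsilon> * (- 2 * u * flat 2 (1 - u\<^sup>2))))"
proof -
  define D where "D = - c * flat 0 (1 - u\<^sup>2) + \<epsilon> * (- 2 * u * flat 2 (1 - u\<^sup>2))"
  let ?N = "normK K x" and ?t = "flat 0 (1 - tail2 K x)"
  have partial: "partial i (\<lambda>x. complex_of_real (almost_ext K c \<epsilon> x)) x
      = complex_of_real (x $ i * (?N powr (- c) / ?N\<^sup>2 * D * ?t))" if "i \<in> K" for i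
  proof -
    have t: "tail2 K (x + t *\<^sub>R axis i 1) = tail2 K x" for t
      unfolding tail2_def using that by (intro sum.cong) (auto simp: axis_def)
    have "(radial c \<epsilon> has_real_derivative ?N powr (- c) / ?N * D) (at (normK K (x + 0 *\<^sub>R axis i 1)))"
      using has_real_derivative_radial[OF assms(1), of c \<epsilon>] by (simp add: D_def u_def)
    from DERIV_cmult_right[OF DERIV_chain2[OF this has_real_derivative_normK_axis[OF that assms(1)]], of ?t]
    have "((\<lambda>t. almost_ext K c \<epsilon> (x + t *\<^sub>R axis i 1)) has_real_derivative
        ?N powr (- c) / ?N * D * (x $ i / ?N) * ?t) (at 0)"
      unfolding almost_ext_def t .
    from has_vector_derivative_of_real[OF this]
    have "((\<lambda>t. complex_of_real (almost_ext K c \<epsilon> (x + t *\<^sub>R axis i 1))) has_vector_derivative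
        complex_of_real (?N powr (- c) / ?N * D * (x $ i / ?N) * ?t)) (at 0)" .
    moreover have "?N powr (- c) / ?N * D * (x $ i / ?N) * ?t = x $ i * (?N powr (- c) / ?N\<^sup>2 * D * ?t)"
      by (simp add: power2_eq_square)
    ultimately show ?thesis unfolding partial_def by (simp only: vector_derivative_at)
  qed
  have "euler_op K (\<lambda>x. complex_of_real (almost_ext K c \<epsilon> x)) x
     = (\<Sum>i\<in>K. complex_of_real ((x $ i)\<^sup>2 * (?N powr (- c) / ?N\<^sup>2 * D * ?t)))"
    unfolding euler_op_def by (intro sum.cong) (simp_all add: partial power2_eq_square)
  also have "\<dots> = complex_of_real (?N\<^sup>2 * (?N powr (- c) / ?N\<^sup>2 * D * ?t))"
    unfolding of_real_sum[symmetric] sum_distrib_right[symmetric] normK_power2[symmetric] ..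
  also have "?N\<^sup>2 * (?N powr (- c) / ?N\<^sup>2 * D * ?t) = ?N powr (- c) * ?t * D"
    using assms by (simp add: field_simps)
  finally show ?thesis unfolding D_def .
qed

lemma norm_almost_ext_weighted:
  assumes "p \<noteq> 0"
  shows "norm (complex_of_real (almost_ext K ((real (card K) - \<alpha>) / p) \<epsilon> x)) powr p / normK K x powr \<alpha>
     = ann_weight K p x * flat 0 (1 - (\<epsilon> * ln (normK K x))\<^sup>2) powr p"
proof -
  have w: "(normK K x powr (- ((real (card K) - \<alpha>) / p))) powr p / normK K x powr \<alpha> = normK K x powr (- real (card K))"
    using assms by (simp add: powr_powr powr_diff[symmetric])
  show ?thesis
    unfolding almost_ext_def radial_def ann_weight_def norm_of_real w[symmetric]
    by (simp add: abs_mult powr_mult)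
qed

lemma norm_euler_almost_ext_weighted:
  fixes \<epsilon> \<alpha> p :: real
  assumes "p \<noteq> 0" "0 < normK K x"
  defines "u \<equiv> \<epsilon> * ln (normK K x)" and "c \<equiv> (real (card K) - \<alpha>) / p"
  shows "norm (euler_op K (\<lambda>x. complex_of_real (almost_ext K c \<epsilon> x)) x) powr p / normK K x powr \<alpha>
     = ann_weight K p x * \<bar>- c * flat 0 (1 - u\<^sup>2) + \<epsilon> * (- 2 * u * flat 2 (1 - u\<^sup>2))\<bar> powr p"
proof -
  have w: "(normK K x powr (- c)) powr p / normK K x powr \<alpha> = normK K x powr (- real (card K))"
    using assms by (simp add: powr_powr powr_diff[symmetric])
  show ?thesis
    unfolding euler_almost_ext[OF assms(2)] u_def[symmetric] ann_weight_def norm_of_real w[symmetric]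
    by (simp add: abs_mult powr_mult)
qed

text \<open>With \<epsilon> = \<theta>^2, splitting by \<open>sum_powr_le\<close> gives the
  derivative of the cutoff the factor (1 + 1/\<theta>) \<epsilon> = \<theta>^2 + \<theta>, which is
  small with \<theta>. This error lives on the annulus |ln N| \<le> 1/\<epsilon>, whose mass is at
  most twice that of its logarithmic half, and there the cutoff is bounded below.\<close>

lemma almost_ext_estimate:
  fixes \<alpha> p \<theta> :: real and K :: "'n::finite set"
  assumes p: "0 < p" and \<theta>: "0 < \<theta>"
  defines "c \<equiv> (real (card K) - \<alpha>) / p"
  defines "F \<equiv> \<lambda>x. complex_of_real (almost_ext K c (\<theta>\<^sup>2) x)"
  shows "(\<integral>x. norm (euler_op K F x) powr p / normK K x powr \<alpha> \<partial>lborel)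
    \<le> ((1 + \<theta>) powr p * \<bar>c\<bar> powr p + (\<theta>\<^sup>2 + \<theta>) powr p * (2 * (4 * exp (4 / 3)) powr p))
       * (\<integral>x. norm (F x) powr p / normK K x powr \<alpha> \<partial>lborel)"
proof -
  define \<epsilon> where "\<epsilon> = \<theta>\<^sup>2"
  have \<epsilon>: "0 < \<epsilon>" using \<theta> by (simp add: \<epsilon>_def)
  have F: "F \<in> test_fun K" unfolding F_def using almost_ext_test_fun[OF \<epsilon>] by (simp add: \<epsilon>_def)
  interpret test_function K F by unfold_locales (rule F)
  define R where "R = 1 / (2 * \<epsilon>)"
  have R: "0 \<le> R" "2 * R = 1 / \<epsilon>" using \<epsilon> by (auto simp: R_def)
  let ?I = "\<integral>x. norm (F x) powr p / normK K x powr \<alpha> \<partial>lborel"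
  let ?B = "\<lambda>x. indicator (annulus K (- (1 / \<epsilon>)) (1 / \<epsilon>)) x * ann_weight K p x"
  let ?b = "(\<theta>\<^sup>2 + \<theta>) powr p * 4 powr p"
  have theta: "(1 + 1 / \<theta>) * \<epsilon> = \<theta>\<^sup>2 + \<theta>"
    using \<theta> by (simp add: \<epsilon>_def field_simps power2_eq_square)
  \<comment> \<open>Pointwise bound by the main term plus an error carried by the full
    annulus.\<close>
  have pw: "norm (euler_op K F x) powr p / normK K x powr \<alpha>
      \<le> (1 + \<theta>) powr p * \<bar>c\<bar> powr p * (norm (F x) powr p / normK K x powr \<alpha>) + ?b * ?B x" for x
  proof (cases "normK K x = 0")
    case True
    then show ?thesis by (simp add: euler_eq_0 f_eq_0 ann_weight_nonneg)
  next
    case False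
    then have N: "0 < normK K x" using normK_nonneg[of K x] by linarith
    define u where "u = \<epsilon> * ln (normK K x)"
    define \<phi> where "\<phi> = flat 0 (1 - u\<^sup>2)"
    define \<psi> where "\<psi> = - 2 * u * flat 2 (1 - u\<^sup>2)"
    have \<phi>0: "0 \<le> \<phi>" by (simp add: \<phi>_def)
    have lhs: "norm (euler_op K F x) powr p / normK K x powr \<alpha> = ann_weight K p x * \<bar>- c * \<phi> + \<epsilon> * \<psi>\<bar> powr p"
      unfolding F_def c_def \<epsilon>_def[symmetric] \<phi>_def \<psi>_def u_def
      using norm_euler_almost_ext_weighted[OF _ N, of p \<alpha> \<epsilon>] p by simp
    have rhs: "norm (F x) powr p / normK K x powr \<alpha> = ann_weight K p x * \<phi> powr p"
      unfolding F_def c_def \<epsilon>_def[symmetric] \<phi>_def u_def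
      using norm_almost_ext_weighted[of p K \<alpha> \<epsilon> x] p by simp
    have "\<bar>- c * \<phi> + \<epsilon> * \<psi>\<bar> \<le> \<bar>c\<bar> * \<phi> + \<epsilon> * \<bar>\<psi>\<bar>"
      using abs_triangle_ineq[of "- c * \<phi>" "\<epsilon> * \<psi>"] \<phi>0 \<epsilon> by (simp add: abs_mult)
    then have "\<bar>- c * \<phi> + \<epsilon> * \<psi>\<bar> powr p \<le> (\<bar>c\<bar> * \<phi> + \<epsilon> * \<bar>\<psi>\<bar>) powr p"
      using p by (intro powr_mono2) auto
    also have "\<dots> \<le> (1 + \<theta>) powr p * (\<bar>c\<bar> * \<phi>) powr p + (1 + 1 / \<theta>) powr p * (\<epsilon> * \<bar>\<psi>\<bar>) powr p"
      using p \<theta> \<epsilon> \<phi>0 by (intro sum_powr_le) auto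
    also have "\<dots> = (1 + \<theta>) powr p * \<bar>c\<bar> powr p * \<phi> powr p + (\<theta>\<^sup>2 + \<theta>) powr p * \<bar>\<psi>\<bar> powr p"
      unfolding theta[symmetric] by (simp add: powr_mult)
    finally have "ann_weight K p x * \<bar>- c * \<phi> + \<epsilon> * \<psi>\<bar> powr p
       \<le> ann_weight K p x * ((1 + \<theta>) powr p * \<bar>c\<bar> powr p * \<phi> powr p + (\<theta>\<^sup>2 + \<theta>) powr p * \<bar>\<psi>\<bar> powr p)"
      by (intro mult_left_mono ann_weight_nonneg)
    moreover have "ann_weight K p x * \<bar>\<psi>\<bar> powr p \<le> 4 powr p * ?B x"
    proof (cases "x \<in> annulus K (- (1 / \<epsilon>)) (1 / \<epsilon>)")
      case True
      then have "u\<^sup>2 \<le> 1\<^sup>2"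
        unfolding u_def using ln_bounds_iff[OF N \<epsilon>, of 1] by (simp add: annulus_def)
      then have "\<bar>u\<bar> \<le> 1" by (simp add: abs_square_le_1)
      \<comment> \<open>The bound 2! = 2 and |u| \<le> 1 give the constant 4 for |\<psi>| = 2 |u|
        \<open>flat 2\<close>.\<close>
      moreover have "flat 2 (1 - u\<^sup>2) \<le> 2" using flat_le_fact[of 2 "1 - u\<^sup>2"] by simp
      ultimately have "\<bar>u\<bar> * flat 2 (1 - u\<^sup>2) \<le> 1 * 2" by (intro mult_mono) auto
      then have "\<bar>\<psi>\<bar> \<le> 4" by (simp add: \<psi>_def abs_mult)
      then have "\<bar>\<psi>\<bar> powr p \<le> 4 powr p" using p by (intro powr_mono2) auto
      then have "ann_weight K p x * \<bar>\<psi>\<bar> powr p \<le> ann_weight K p x * 4 powr p"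
        by (intro mult_left_mono ann_weight_nonneg)
      then show ?thesis using True by (simp add: mult.commute)
    next
      case False
      from flat_cutoff_outside[OF \<epsilon> N False, of 2 0]
      have "ann_weight K p x * \<bar>\<psi>\<bar> powr p = 0"
        by (auto simp: \<psi>_def ann_weight_def u_def)
      then show ?thesis using False by auto
    qed
    then have "(\<theta>\<^sup>2 + \<theta>) powr p * (ann_weight K p x * \<bar>\<psi>\<bar> powr p) \<le> (\<theta>\<^sup>2 + \<theta>) powr p * (4 powr p * ?B x)"
      by (intro mult_left_mono) auto
    ultimately show ?thesis unfolding lhs rhs by (simp add: algebra_simps)
  qed
  have half: "exp (- (4 / 3)) powr p * (indicator (annulus K (- R) R) x * ann_weight K p x)
      \<le> norm (F x) powr p / normK K x powr \<alpha>" for x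
  proof (cases "x \<in> annulus K (- R) R")
    case True
    then have N: "0 < normK K x" by (rule normK_pos_annulus)
    define u where "u = \<epsilon> * ln (normK K x)"
    have rhs: "norm (F x) powr p / normK K x powr \<alpha> = ann_weight K p x * flat 0 (1 - u\<^sup>2) powr p"
      unfolding F_def c_def \<epsilon>_def[symmetric] u_def
      using norm_almost_ext_weighted[of p K \<alpha> \<epsilon> x] p by simp
    \<comment> \<open>On the half annulus |u| \<le> 1/2, so 1 - u^2 \<ge> 3/4 and the cutoff is at
      least exp(-4/3).\<close>
    have "u\<^sup>2 \<le> (1 / 2)\<^sup>2"
      unfolding u_def using ln_bounds_iff[OF N \<epsilon>, of "1 / 2"] True by (simp add: annulus_def R_def)
    then have u: "3 / 4 \<le> 1 - u\<^sup>2" by (simp add: power2_eq_square)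
    then have "inverse (1 - u\<^sup>2) \<le> inverse (3 / 4)" by (intro le_imp_inverse_le) auto
    then have "exp (- (4 / 3)) \<le> flat 0 (1 - u\<^sup>2)" using u by (simp add: flat_def)
    then have "exp (- (4 / 3)) powr p \<le> flat 0 (1 - u\<^sup>2) powr p" using p by (intro powr_mono2) auto
    then have "ann_weight K p x * exp (- (4 / 3)) powr p \<le> ann_weight K p x * flat 0 (1 - u\<^sup>2) powr p"
      by (intro mult_left_mono ann_weight_nonneg)
    then show ?thesis unfolding rhs using True by (simp add: mult.commute)
  qed simp
  have "exp (- (4 / 3)) powr p * ann_mass K p (- R) R \<le> ?I"
    unfolding ann_mass_def Bochner_Integration.integral_mult_right[OF integrable_ann_mass[OF p], symmetric]
    by (intro integral_mono half integrable_mult_right integrable_ann_mass integrable_f p)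
  then have "exp (4 / 3) powr p * (exp (- (4 / 3)) powr p * ann_mass K p (- R) R) \<le> exp (4 / 3) powr p * ?I"
    by (intro mult_left_mono) auto
  moreover have "exp (4 / 3) powr p * exp (- (4 / 3)) powr p = (1::real)"
    by (simp add: powr_mult[symmetric] exp_minus)
  ultimately have "ann_mass K p (- R) R \<le> exp (4 / 3) powr p * ?I"
    by (simp flip: mult.assoc)
  moreover have "ann_mass K p (- (1 / \<epsilon>)) (1 / \<epsilon>) \<le> 2 * ann_mass K p (- R) R"
    using ann_mass_double[OF p R(1), of K] R(2) by simp
  ultimately have mass: "ann_mass K p (- (1 / \<epsilon>)) (1 / \<epsilon>) \<le> 2 * exp (4 / 3) powr p * ?I" by linarith
  have "(\<integral>x. norm (euler_op K F x) powr p / normK K x powr \<alpha> \<partial>lborel)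
     \<le> (\<integral>x. (1 + \<theta>) powr p * \<bar>c\<bar> powr p * (norm (F x) powr p / normK K x powr \<alpha>) + ?b * ?B x \<partial>lborel)"
    by (intro integral_mono pw Bochner_Integration.integrable_add integrable_mult_right integrable_ann_mass
        integrable_f integrable_euler p)
  also have "\<dots> = (1 + \<theta>) powr p * \<bar>c\<bar> powr p * ?I + ?b * ann_mass K p (- (1 / \<epsilon>)) (1 / \<epsilon>)"
    unfolding ann_mass_def
    by (subst Bochner_Integration.integral_add)
       (auto intro!: integrable_mult_right integrable_ann_mass integrable_f p simp del: times_divide_eq_right)
  also have "\<dots> \<le> (1 + \<theta>) powr p * \<bar>c\<bar> powr p * ?I + ?b * (2 * exp (4 / 3) powr p * ?I)"
    by (intro add_left_mono mult_left_mono mass) auto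
  finally show ?thesis by (simp add: powr_mult algebra_simps)
qed

text \<open>The factor \<open>D \<theta>\<close> from \<open>almost_ext_estimate\<close> tends to
  |c|^p as \<theta> decreases to 0, so it falls below C for some \<theta> > 0.\<close>

lemma hardy_sharp:
  fixes \<alpha> p C :: real and K :: "'n::finite set"
  assumes "K \<noteq> {}" "1 < p" "\<bar>(real (card K) - \<alpha>) / p\<bar> powr p < C"
  shows "\<exists>f\<in>test_fun K. C * (\<integral>x. norm (f x) powr p / normK K x powr \<alpha> \<partial>lborel)
             > (\<integral>x. norm (euler_op K f x) powr p / normK K x powr \<alpha> \<partial>lborel)"
proof -
  define c where "c = (real (card K) - \<alpha>) / p"
  define D where "D \<theta> = (1 + \<theta>) powr p * \<bar>c\<bar> powr p + (\<theta>\<^sup>2 + \<theta>) powr p * (2 * (4 * exp (4 / 3)) powr p)" for \<theta>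
  have p: "0 < p" using assms(2) by simp
  have "((\<lambda>\<theta>. (\<theta>\<^sup>2 + \<theta>) powr p) \<longlongrightarrow> (0\<^sup>2 + 0) powr p) (at_right (0::real))"
    using p by (intro tendsto_powr' tendsto_intros) (auto simp: eventually_at_filter)
  moreover have "((\<lambda>\<theta>. (1 + \<theta>) powr p) \<longlongrightarrow> (1 + 0) powr p) (at_right (0::real))"
    by (intro tendsto_intros) auto
  ultimately have "(D \<longlongrightarrow> (1 + 0) powr p * \<bar>c\<bar> powr p + (0\<^sup>2 + 0) powr p * (2 * (4 * exp (4 / 3)) powr p)) (at_right 0)"
    unfolding D_def by (intro tendsto_add tendsto_mult tendsto_const)
  then have "(D \<longlongrightarrow> \<bar>c\<bar> powr p) (at_right 0)" by simp
  then have "\<forall>\<^sub>F \<theta> in at_right 0. D \<theta> < C"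
    using assms(3) by (intro order_tendstoD) (auto simp: c_def)
  then have "\<forall>\<^sub>F \<theta> in at_right 0. 0 < \<theta> \<and> D \<theta> < C"
    using eventually_at_right_less by (intro eventually_conj) auto
  then obtain \<theta> where \<theta>: "0 < \<theta>" "D \<theta> < C"
    using eventually_happens'[OF trivial_limit_at_right_real] by blast
  define F where "F = (\<lambda>x. complex_of_real (almost_ext K c (\<theta>\<^sup>2) x))"
  have F: "F \<in> test_fun K" unfolding F_def using almost_ext_test_fun[of "\<theta>\<^sup>2"] \<theta> by simp
  interpret test_function K F by unfold_locales (rule F)
  \<comment> \<open>A unit vector in a direction of \<open>K\<close> has N = 1 and x'' = 0, where
    both cutoffs equal exp(-1). Thus F is nonzero, its weighted integral is positive, and D \<theta>
    < C yields a strict inequality.\<close>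
  obtain i where i: "i \<in> K" using assms(1) by blast
  have "(normK K (axis i 1))\<^sup>2 = 1"
    using normK_axis_power2[OF i, of 0 1] by (simp add: normK_eq_0_iff)
  then have "normK K (axis i 1) = 1" by (intro power2_eq_imp_eq[of _ 1]) auto
  moreover have "tail2 K (axis i 1) = 0"
    unfolding tail2_def using i by (intro sum.neutral) (auto simp: axis_def)
  ultimately have "F (axis i 1) \<noteq> 0"
    by (simp add: F_def almost_ext_def radial_def flat_def)
  then have "0 < (\<integral>x. norm (F x) powr p / normK K x powr \<alpha> \<partial>lborel)"
    by (intro integral_f_pos p) auto
  then have "D \<theta> * (\<integral>x. norm (F x) powr p / normK K x powr \<alpha> \<partial>lborel)
     < C * (\<integral>x. norm (F x) powr p / normK K x powr \<alpha> \<partial>lborel)"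
    using \<theta>(2) by simp
  then show ?thesis
    using almost_ext_estimate[OF p \<theta>(1), of K \<alpha>] F
    unfolding D_def c_def F_def by (intro bexI[of _ F]) (auto simp: F_def c_def)
qed

theorem theorem3p1:
  fixes K :: "'n::finite set" and p \<alpha> :: real
  assumes "K \<noteq> {}" and "1 < p"
  shows
   "(\<forall>f\<in>test_fun K.
       \<bar>(real (card K) - \<alpha>) / p\<bar> powr p *
         (\<integral>x. norm (f x) powr p / normK K x powr \<alpha> \<partial>lborel)
       \<le> (\<integral>x. norm (euler_op K f x) powr p / normK K x powr \<alpha> \<partial>lborel))
    \<and> (\<alpha> \<noteq> real (card K) \<longrightarrow>
       (\<forall>C. C > \<bar>(real (card K) - \<alpha>) / p\<bar> powr p \<longrightarrow>
          (\<exists>f\<in>test_fun K.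
             C * (\<integral>x. norm (f x) powr p / normK K x powr \<alpha> \<partial>lborel)
             > (\<integral>x. norm (euler_op K f x) powr p / normK K x powr \<alpha> \<partial>lborel))))
    \<and> (\<forall>f\<in>test_fun K.
       \<bar>(real (card K) - \<alpha>) / p\<bar> powr p *
         (\<integral>x. norm (f x / complex_of_real (normK K x powr (\<alpha> / p))) powr p \<partial>lborel)
       = (\<integral>x. norm (euler_op K f x / complex_of_real (normK K x powr (\<alpha> / p))) powr p \<partial>lborel)
         - (\<integral>x. Cp p (euler_op K f x / complex_of_real (normK K x powr (\<alpha> / p)))
                 (euler_op K f x / complex_of_real (normK K x powr (\<alpha> / p))
                  + complex_of_real ((real (card K) - \<alpha>) / p)
                    * (f x / complex_of_real (normK K x powr (\<alpha> / p)))) \<partial>lborel))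
    \<and> (2 \<le> p \<longrightarrow>
       (\<forall>f\<in>test_fun K. f \<noteq> (\<lambda>_. 0) \<longrightarrow>
          (\<integral>x. Cp p (euler_op K f x / complex_of_real (normK K x powr (\<alpha> / p)))
                 (euler_op K f x / complex_of_real (normK K x powr (\<alpha> / p))
                  + complex_of_real ((real (card K) - \<alpha>) / p)
                    * (f x / complex_of_real (normK K x powr (\<alpha> / p)))) \<partial>lborel) > 0
          \<and> \<bar>(real (card K) - \<alpha>) / p\<bar> powr p *
              (\<integral>x. norm (f x) powr p / normK K x powr \<alpha> \<partial>lborel)
            < (\<integral>x. norm (euler_op K f x) powr p / normK K x powr \<alpha> \<partial>lborel)))"
proof (intro conjI impI ballI allI)
  fix f assume "f \<in> test_fun K"
  then interpret test_function K f by unfold_locales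
  show "\<bar>(real (card K) - \<alpha>) / p\<bar> powr p * (\<integral>x. norm (f x) powr p / normK K x powr \<alpha> \<partial>lborel)
       \<le> (\<integral>x. norm (euler_op K f x) powr p / normK K x powr \<alpha> \<partial>lborel)"
    by (rule hardy_inequality[OF assms(2)])
next
  fix C assume "C > \<bar>(real (card K) - \<alpha>) / p\<bar> powr p"
  then show "\<exists>f\<in>test_fun K. C * (\<integral>x. norm (f x) powr p / normK K x powr \<alpha> \<partial>lborel)
             > (\<integral>x. norm (euler_op K f x) powr p / normK K x powr \<alpha> \<partial>lborel)"
    by (rule hardy_sharp[OF assms])
next
  fix f assume "f \<in> test_fun K"
  then interpret test_function K f by unfold_locales
  have "p \<noteq> 0" using assms(2) by simp
  then show "\<bar>(real (card K) - \<alpha>) / p\<bar> powr p *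
         (\<integral>x. norm (f x / complex_of_real (normK K x powr (\<alpha> / p))) powr p \<partial>lborel)
       = (\<integral>x. norm (euler_op K f x / complex_of_real (normK K x powr (\<alpha> / p))) powr p \<partial>lborel)
         - (\<integral>x. Cp p (euler_op K f x / complex_of_real (normK K x powr (\<alpha> / p)))
                 (euler_op K f x / complex_of_real (normK K x powr (\<alpha> / p))
                  + complex_of_real ((real (card K) - \<alpha>) / p)
                    * (f x / complex_of_real (normK K x powr (\<alpha> / p)))) \<partial>lborel)"
    using integral_remainder[OF assms(2), of \<alpha>]
    unfolding norm_divide_weight_powr[OF \<open>p \<noteq> 0\<close>] remainder_def[OF assms(2), symmetric] by linarith
next
  fix f assume "f \<in> test_fun K" and nz: "f \<noteq> (\<lambda>_. 0)"
  then interpret test_function K f by unfold_locales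
  show "(\<integral>x. Cp p (euler_op K f x / complex_of_real (normK K x powr (\<alpha> / p)))
                 (euler_op K f x / complex_of_real (normK K x powr (\<alpha> / p))
                  + complex_of_real ((real (card K) - \<alpha>) / p)
                    * (f x / complex_of_real (normK K x powr (\<alpha> / p)))) \<partial>lborel) > 0"
    unfolding remainder_def[OF assms(2), symmetric] by (rule integral_remainder_pos[OF nz assms(2)])
  show "\<bar>(real (card K) - \<alpha>) / p\<bar> powr p * (\<integral>x. norm (f x) powr p / normK K x powr \<alpha> \<partial>lborel)
            < (\<integral>x. norm (euler_op K f x) powr p / normK K x powr \<alpha> \<partial>lborel)"
    using integral_remainder_pos[OF nz assms(2), of \<alpha>] integral_remainder[OF assms(2), of \<alpha>] by linarith
qed

end
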